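(* Let $M$ be a second countable smooth manifold. Then the group $\mathrm{Diff}(M)$ of all smooth diffeomorphisms of $M$ is natural (as an abstract group).
   Context: Manifolds are finite-dimensional and Hausdorff. The group operation on $\mathrm{Diff}(M)$ is composition. A group $(G,* )$ is called natural if there exists a metric $d$ on the set $G$ such that (i) all right translations $x \mapsto x*a$ ($a \in G$) are isometries of $(G,d)$, and (ii) every group structure $(G,\circ)$ on the same set $G$ for which all right translations $x \mapsto x \circ a$ are isometries of $(G,d)$ is isomorphic as a group to $(G,* )$. *)

theory Defs
  imports "HOL-Analysis.Analysis" "HOL-Algebra.Bij"
begin

section \<open>Smooth manifolds\<close>

text \<open>
  Charts take values in a finite-dimensional real inner product space, i.e. a copy of
  \<open>\<real>\<^sup>n\<close>. The class \<^class>\<open>euclidean_space\<close> would exclude \<open>n = 0\<close>, hence \<^class>\<open>real_inner\<close>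
  together with an explicit dimension assumption.
\<close>

definition finite_dim :: "'e::real_inner itself \<Rightarrow> bool" where
  "finite_dim TYPE('e) \<longleftrightarrow> (\<exists>B :: 'e set. finite B \<and> span B = UNIV)"

text \<open>
  Only used for open \<open>S\<close> and in finite dimension: there, differentiability of the derivative is
  differentiability of all the maps \<open>x \<mapsto> Df(x) v\<close>.
\<close>

primrec times_differentiable_on ::
    "nat \<Rightarrow> 'e::real_normed_vector set \<Rightarrow> ('e \<Rightarrow> 'f::real_normed_vector) \<Rightarrow> bool" where
  "times_differentiable_on 0 S = (\<lambda>f. continuous_on S f)"
| "times_differentiable_on (Suc k) S = (\<lambda>f.
     (\<forall>x\<in>S. f differentiable (at x)) \<and>
     (\<forall>v. times_differentiable_on k S (\<lambda>x. frechet_derivative f (at x) v)))"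

definition smooth_on :: "'e::real_normed_vector set \<Rightarrow> ('e \<Rightarrow> 'f::real_normed_vector) \<Rightarrow> bool" where
  "smooth_on S f \<longleftrightarrow> (\<forall>k. times_differentiable_on k S f)"

text \<open>A chart is a pair of its domain and its coordinate map, which is irrelevant off the domain.\<close>

type_synonym ('a, 'e) chart = "'a set \<times> ('a \<Rightarrow> 'e)"

definition is_chart :: "'a topology \<Rightarrow> ('a, 'e::real_inner) chart \<Rightarrow> bool" where
  "is_chart X = (\<lambda>(U, \<phi>). openin X U \<and> open (\<phi> ` U) \<and>
     homeomorphic_map (subtopology X U) (top_of_set (\<phi> ` U)) \<phi>)"

text \<open>Both orders of a pair of charts occur, so the transition maps are diffeomorphisms.\<close>

definition smooth_atlas :: "'a topology \<Rightarrow> ('a, 'e::real_inner) chart set \<Rightarrow> bool" where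
  "smooth_atlas X A \<longleftrightarrow>
     (\<forall>c\<in>A. is_chart X c) \<and>
     (\<Union>(U, \<phi>)\<in>A. U) = topspace X \<and>
     (\<forall>(U, \<phi>)\<in>A. \<forall>(V, \<psi>)\<in>A. smooth_on (\<phi> ` (U \<inter> V)) (\<psi> \<circ> inv_into U \<phi>))"

text \<open>
  The atlas need not be maximal: it represents the smooth structure it generates, and smoothness
  of maps does not depend on the choice of atlas in that structure.
\<close>

definition smooth_manifold :: "'a topology \<Rightarrow> ('a, 'e::real_inner) chart set \<Rightarrow> bool" where
  "smooth_manifold X A \<longleftrightarrow> finite_dim TYPE('e) \<and> Hausdorff_space X \<and> smooth_atlas X A"

definition smooth_map ::
    "'a topology \<Rightarrow> ('a, 'e::real_inner) chart set \<Rightarrow> 'b topology \<Rightarrow> ('b, 'f::real_inner) chart set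
      \<Rightarrow> ('a \<Rightarrow> 'b) \<Rightarrow> bool" where
  "smooth_map X A Y B f \<longleftrightarrow> continuous_map X Y f \<and>
     (\<forall>(U, \<phi>)\<in>A. \<forall>(V, \<psi>)\<in>B.
        smooth_on (\<phi> ` {x \<in> U. f x \<in> V}) (\<psi> \<circ> f \<circ> inv_into U \<phi>))"

section \<open>The diffeomorphism group\<close>

text \<open>
  As in \<^const>\<open>BijGroup\<close>, diffeomorphisms are extensional functions, so that each is represented
  by exactly one element; the operation is composition.
\<close>

definition Diff :: "'a topology \<Rightarrow> ('a, 'e::real_inner) chart set \<Rightarrow> ('a \<Rightarrow> 'a) monoid" where
  "Diff X A = (BijGroup (topspace X))
     \<lparr>carrier := {f \<in> Bij (topspace X).
        smooth_map X A X A f \<and> smooth_map X A X A (inv_into (topspace X) f)}\<rparr>"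

section \<open>Natural groups\<close>

text \<open>
  Right translations of a group are bijections of its carrier, so being an isometry amounts to
  preserving distances.
\<close>

definition right_translations_isometric :: "('a, 'b) monoid_scheme \<Rightarrow> ('a \<Rightarrow> 'a \<Rightarrow> real) \<Rightarrow> bool" where
  "right_translations_isometric G d \<longleftrightarrow>
     (\<forall>a\<in>carrier G. \<forall>x\<in>carrier G. \<forall>y\<in>carrier G. d (x \<otimes>\<^bsub>G\<^esub> a) (y \<otimes>\<^bsub>G\<^esub> a) = d x y)"

definition natural_group :: "('a, 'b) monoid_scheme \<Rightarrow> bool" where
  "natural_group G \<longleftrightarrow> group G \<and>
     (\<exists>d. Metric_space (carrier G) d \<and> right_translations_isometric G d \<and>
        (\<forall>H :: 'a monoid. group H \<and> carrier H = carrier G \<and> right_translations_isometric H d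
           \<longrightarrow> H \<cong> G))"

end

theory Submission
  imports Defs
begin

text \<open>
  A metric \<open>d\<close> on a group for which right translations are isometries has the form
  \<open>d x y = \<bar>x y\<inverse>\<bar>\<close> for a length with \<open>\<bar>g\<inverse>\<bar> = \<bar>g\<bar>\<close>. A length can therefore distinguish elements only up
  to inversion, and if the group has at most continuum many elements, some length does distinguish
  them to that extent: if its values off the unit lie between 1 and 2, the triangle inequality is
  automatic, so that the values can be chosen at will. The diffeomorphism group has at most
  continuum many elements, since a continuous self-map of a second countable Hausdorff space is
  determined by the pairs of basic open sets \<open>(b, c)\<close> such that it maps \<open>b\<close> into \<open>c\<close>
  (\<open>continuous_maps_inject_into_reals\<close>).

  With such a length, an isometry that fixes the unit sends every \<open>x\<close> to \<open>x\<close> or to \<open>x\<inverse>\<close>. Suppose it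
  sends \<open>x\<close> to \<open>x\<inverse> \<noteq> x\<close>. Comparing the distances of \<open>x\<close> and \<open>y\<close> and of their images shows that, for
  every \<open>y\<close>, either \<open>x\<close> commutes with \<open>y\<close>, or conjugation by \<open>x\<close> inverts \<open>y\<close>, or \<open>y\<^sup>2 = x\<^sup>2\<close>. Hence,
  if every \<open>x\<close> with \<open>x\<^sup>2 \<noteq> 1\<close> has a witness \<open>y\<close> violating all three conditions, every isometry is a right
  translation of the group. The right translations of any competing group structure then are right
  translations of the given group, which yields an isomorphism (\<open>natural_groupI\<close>).

  Witnesses in the diffeomorphism group come from its local richness (\<open>Diff_noncommuting_witness\<close>).
  If \<open>x\<^sup>2 \<noteq> 1\<close>, some point \<open>p\<close> differs from both \<open>x p\<close> and \<open>x (x p)\<close>. In positive dimension, take a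
  diffeomorphism \<open>y\<close> that moves \<open>p\<close> and is supported in a neighbourhood \<open>W\<close> of \<open>p\<close> which is disjoint
  from \<open>x W\<close> and \<open>x (x W)\<close>: it differs from its conjugate, which is supported in \<open>x W\<close>, and from the
  inverse of its conjugate, and \<open>y\<^sup>2\<close> maps \<open>W\<close> to itself whereas \<open>x\<^sup>2\<close> does not. In dimension 0 all
  permutations are diffeomorphisms, and the transposition of \<open>p\<close> and \<open>x p\<close> is a witness.

  The diffeomorphism \<open>y\<close> is given in a chart by \<open>x \<mapsto> x + g x v\<close>, where \<open>v\<close> is a unit vector and \<open>g\<close> a
  bump function with Lipschitz constant at most 1/2
  (\<open>directional_perturbation_diffeomorphism\<close>), and by the identity outside the chart.
\<close>

section \<open>A criterion for a group to be natural\<close>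

text \<open>
  Taking the minimum makes the length invariant under inversion; the arctangent squeezes arbitrary
  real labels \<open>\<iota>\<close> into the interval from 1 to 2, where no triangle inequality can fail.
\<close>

definition (in group) separating_length :: "('a \<Rightarrow> real) \<Rightarrow> 'a \<Rightarrow> real" where
  "separating_length \<iota> g = (if g = \<one> then 0 else 3/2 + arctan (min (\<iota> g) (\<iota> (inv g))) / pi)"

lemma (in group) separating_length_bounds:
  "g \<noteq> \<one> \<Longrightarrow> 1 < separating_length \<iota> g \<and> separating_length \<iota> g < 2"
  using arctan_bounded[of "min (\<iota> g) (\<iota> (inv g))"]
  by (simp add: separating_length_def field_simps)

text \<open>
  Equal lengths force the minimal labels to agree; as the labels are injective, the elements bearing
  them agree, and each of these is one of the given elements or its inverse.
\<close>

lemma (in group) separating_length_eqD: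
  assumes inj: "inj_on \<iota> (carrier G)" and g: "g \<in> carrier G" and h: "h \<in> carrier G"
    and eq: "separating_length \<iota> g = separating_length \<iota> h"
  shows "g = h \<or> g = inv h"
proof (cases "g = \<one> \<or> h = \<one>")
  case True
  then show ?thesis
    using eq separating_length_bounds[of g \<iota>] separating_length_bounds[of h \<iota>]
    by (auto simp: separating_length_def split: if_splits)
next
  case False
  with eq have "min (\<iota> g) (\<iota> (inv g)) = min (\<iota> h) (\<iota> (inv h))"
    by (simp add: separating_length_def arctan_eq_iff)
  then have "\<iota> g = \<iota> h \<or> \<iota> g = \<iota> (inv h) \<or> \<iota> (inv g) = \<iota> h \<or> \<iota> (inv g) = \<iota> (inv h)"
    by (auto simp: min_def split: if_splits)
  then have "g = h \<or> g = inv h \<or> inv g = h \<or> inv g = inv h"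
    using inj g h by (auto dest: inj_onD)
  then show ?thesis using g h by (metis inv_inv)
qed

lemma (in group) Metric_space_separating_length:
  "Metric_space (carrier G) (\<lambda>x y. if x \<in> carrier G \<and> y \<in> carrier G
     then separating_length \<iota> (x \<otimes> inv y) else 0)" (is "Metric_space _ ?d")
proof
  fix x y
  show "0 \<le> ?d x y"
    using separating_length_bounds[of "x \<otimes> inv y" \<iota>]
    by (cases "x \<otimes> inv y = \<one>") (auto simp: separating_length_def)
  show "?d x y = ?d y x"
  proof (cases "x \<in> carrier G \<and> y \<in> carrier G")
    case True
    then have "inv (x \<otimes> inv y) = y \<otimes> inv x" by (simp add: inv_mult_group)
    moreover have "inv (y \<otimes> inv x) = x \<otimes> inv y" using True by (simp add: inv_mult_group)
    moreover have "x \<otimes> inv y = \<one> \<longleftrightarrow> y \<otimes> inv x = \<one>"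
      using True by (metis calculation inv_one)
    ultimately show ?thesis using True by (simp add: separating_length_def min.commute)
  qed auto
next
  fix x y assume xy: "x \<in> carrier G" "y \<in> carrier G"
  then have "x \<otimes> inv y = \<one> \<longleftrightarrow> x = y"
    by (metis inv_closed inv_equality inv_inv r_inv)
  then show "?d x y = 0 \<longleftrightarrow> x = y"
    using xy separating_length_bounds[of "x \<otimes> inv y" \<iota>] by (auto simp: separating_length_def)
next
  fix x y z assume xyz: "x \<in> carrier G" "y \<in> carrier G" "z \<in> carrier G"
  have one: "a \<otimes> inv b = \<one> \<longleftrightarrow> a = b" if "a \<in> carrier G" "b \<in> carrier G" for a b
    using that by (metis inv_closed inv_equality inv_inv r_inv)
  show "?d x z \<le> ?d x y + ?d y z"
    using xyz one[of x y] one[of y z] one[of x z]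
      separating_length_bounds[of "x \<otimes> inv y" \<iota>] separating_length_bounds[of "y \<otimes> inv z" \<iota>]
      separating_length_bounds[of "x \<otimes> inv z" \<iota>]
    by (cases "x = y"; cases "y = z"; cases "x = z") (auto simp: separating_length_def)
qed

text \<open>
  The assumption on \<open>f\<close> is what the separating length yields for an isometry. It does not exclude
  inversions by itself: in an abelian group \<open>x \<mapsto> x\<inverse>\<close> satisfies it. The witness \<open>y\<close>
  excludes each of the ways in which \<open>f\<close> could invert \<open>x\<close>.
\<close>

lemma (in group) isometry_fixing_one_is_identity:
  assumes witness: "\<And>x. \<lbrakk>x \<in> carrier G; x \<otimes> x \<noteq> \<one>\<rbrakk> \<Longrightarrow>
      \<exists>y\<in>carrier G. x \<otimes> y \<noteq> y \<otimes> x \<and> x \<otimes> y \<noteq> inv y \<otimes> x \<and> y \<otimes> y \<noteq> x \<otimes> x"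
    and f: "f \<in> carrier G \<rightarrow> carrier G" "f \<one> = \<one>"
    and iso: "\<And>x y. \<lbrakk>x \<in> carrier G; y \<in> carrier G\<rbrakk> \<Longrightarrow>
      f x \<otimes> inv (f y) = x \<otimes> inv y \<or> f x \<otimes> inv (f y) = y \<otimes> inv x"
    and x: "x \<in> carrier G"
  shows "f x = x"
proof (rule ccontr)
  assume neq: "f x \<noteq> x"
  have f_cases: "f y = y \<or> f y = inv y" if "y \<in> carrier G" for y
  proof -
    have "f y \<in> carrier G" using f(1) that by auto
    then show ?thesis using iso[OF that one_closed] that f(2) by simp
  qed
  have fx: "f x = inv x" using f_cases[OF x] neq by blast
  have "x \<otimes> x \<noteq> \<one>" using fx neq x inv_equality by metis
  then obtain y where y: "y \<in> carrier G" "x \<otimes> y \<noteq> y \<otimes> x" "x \<otimes> y \<noteq> inv y \<otimes> x" "y \<otimes> y \<noteq> x \<otimes> x"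
    using witness x by blast
  show False
  proof (cases "f y = y")
    case True
    have "inv x \<otimes> inv y \<noteq> x \<otimes> inv y" using neq fx x y by simp
    then have "inv x \<otimes> inv y = y \<otimes> inv x" using iso[OF x y(1)] fx True by simp
    then have "inv y = x \<otimes> y \<otimes> inv x"
      using x y(1) by (metis inv_closed inv_solve_left m_assoc m_closed)
    then show False using x y(1,3) by (simp add: inv_solve_right)
  next
    case False
    then have fy: "f y = inv y" using f_cases y by blast
    then consider "inv x \<otimes> y = x \<otimes> inv y" | "inv x \<otimes> y = y \<otimes> inv x"
      using iso[OF x y(1)] fx y(1) by auto
    then show False
    proof cases
      case 1
      then have "y = x \<otimes> x \<otimes> inv y"
        using x y(1) by (metis inv_closed inv_solve_left m_assoc m_closed)
      then show False using x y(1,4) by (simp add: inv_solve_right)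
    next
      case 2
      then have "y = x \<otimes> y \<otimes> inv x"
        using x y(1) by (metis inv_closed inv_solve_left m_assoc m_closed)
      then show False using x y(1,2) by (simp add: inv_solve_right)
    qed
  qed
qed

text \<open>
  Right translation by \<open>a\<close> in a competing group \<open>H\<close> is an isometry; followed by the translation of \<open>G\<close>
  that takes the image of \<open>\<one>\<^bsub>G\<^esub>\<close> back to \<open>\<one>\<^bsub>G\<^esub>\<close> it fixes the unit, hence is the identity. So it equals
  right translation in \<open>G\<close> by \<open>\<one>\<^bsub>G\<^esub> \<otimes>\<^bsub>H\<^esub> a\<close>, and associativity of \<open>H\<close> makes \<open>a \<mapsto> \<one>\<^bsub>G\<^esub> \<otimes>\<^bsub>H\<^esub> a\<close> a homomorphism.
\<close>

theorem natural_groupI: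
  assumes G: "group G" and inj: "inj_on (\<iota> :: 'a \<Rightarrow> real) (carrier G)"
    and witness: "\<And>x. \<lbrakk>x \<in> carrier G; x \<otimes>\<^bsub>G\<^esub> x \<noteq> \<one>\<^bsub>G\<^esub>\<rbrakk> \<Longrightarrow>
      \<exists>y\<in>carrier G. x \<otimes>\<^bsub>G\<^esub> y \<noteq> y \<otimes>\<^bsub>G\<^esub> x \<and> x \<otimes>\<^bsub>G\<^esub> y \<noteq> inv\<^bsub>G\<^esub> y \<otimes>\<^bsub>G\<^esub> x \<and>
        y \<otimes>\<^bsub>G\<^esub> y \<noteq> x \<otimes>\<^bsub>G\<^esub> x"
  shows "natural_group G"
proof -
  interpret group G by (fact G)
  define d where "d = (\<lambda>x y. if x \<in> carrier G \<and> y \<in> carrier G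
     then separating_length \<iota> (x \<otimes>\<^bsub>G\<^esub> inv\<^bsub>G\<^esub> y) else 0)"
  have metric: "Metric_space (carrier G) d"
    unfolding d_def by (rule Metric_space_separating_length)
  have cancel: "(x \<otimes>\<^bsub>G\<^esub> a) \<otimes>\<^bsub>G\<^esub> inv\<^bsub>G\<^esub> (y \<otimes>\<^bsub>G\<^esub> a) = x \<otimes>\<^bsub>G\<^esub> inv\<^bsub>G\<^esub> y"
    if "x \<in> carrier G" "y \<in> carrier G" "a \<in> carrier G" for x y a
  proof -
    have "a \<otimes>\<^bsub>G\<^esub> (inv\<^bsub>G\<^esub> a \<otimes>\<^bsub>G\<^esub> inv\<^bsub>G\<^esub> y) = inv\<^bsub>G\<^esub> y"
      using that by (simp add: m_assoc[symmetric])
    then show ?thesis using that by (simp add: inv_mult_group m_assoc)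
  qed
  have G_iso: "right_translations_isometric G d"
    unfolding right_translations_isometric_def d_def by (simp add: cancel)
  have "H \<cong> G" if H: "group H" and car: "carrier H = carrier G"
    and H_iso: "right_translations_isometric H d" for H :: "'a monoid"
  proof -
    interpret H: group H by (fact H)
    have Hm: "x \<otimes>\<^bsub>H\<^esub> a \<in> carrier G" if "x \<in> carrier G" "a \<in> carrier G" for x a
      using that H.m_closed car by simp
    have key: "x \<otimes>\<^bsub>H\<^esub> a = x \<otimes>\<^bsub>G\<^esub> (\<one>\<^bsub>G\<^esub> \<otimes>\<^bsub>H\<^esub> a)" if x: "x \<in> carrier G" and a: "a \<in> carrier G" for x a
    proof -
      let ?b = "\<one>\<^bsub>G\<^esub> \<otimes>\<^bsub>H\<^esub> a"
      have b: "?b \<in> carrier G" using Hm a by simp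
      \<comment> \<open>the translation of \<open>H\<close>, moved back so that it fixes the unit of \<open>G\<close>\<close>
      define f where "f = (\<lambda>x. (x \<otimes>\<^bsub>H\<^esub> a) \<otimes>\<^bsub>G\<^esub> inv\<^bsub>G\<^esub> ?b)"
      have "f x = x"
      proof (rule isometry_fixing_one_is_identity[OF witness])
        show "f \<in> carrier G \<rightarrow> carrier G" using Hm a by (auto simp: f_def)
        show "f \<one>\<^bsub>G\<^esub> = \<one>\<^bsub>G\<^esub>" using b by (simp add: f_def)
        fix u v assume uv: "u \<in> carrier G" "v \<in> carrier G"
        have fuv: "f u \<otimes>\<^bsub>G\<^esub> inv\<^bsub>G\<^esub> (f v) = (u \<otimes>\<^bsub>H\<^esub> a) \<otimes>\<^bsub>G\<^esub> inv\<^bsub>G\<^esub> (v \<otimes>\<^bsub>H\<^esub> a)"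
          unfolding f_def using uv a b Hm by (intro cancel) auto
        have "d (u \<otimes>\<^bsub>H\<^esub> a) (v \<otimes>\<^bsub>H\<^esub> a) = d u v"
          using H_iso uv a car by (auto simp: right_translations_isometric_def)
        then have "separating_length \<iota> ((u \<otimes>\<^bsub>H\<^esub> a) \<otimes>\<^bsub>G\<^esub> inv\<^bsub>G\<^esub> (v \<otimes>\<^bsub>H\<^esub> a)) =
            separating_length \<iota> (u \<otimes>\<^bsub>G\<^esub> inv\<^bsub>G\<^esub> v)"
          using uv a Hm by (simp add: d_def)
        from separating_length_eqD[OF inj _ _ this]
        show "f u \<otimes>\<^bsub>G\<^esub> inv\<^bsub>G\<^esub> (f v) = u \<otimes>\<^bsub>G\<^esub> inv\<^bsub>G\<^esub> v \<or> f u \<otimes>\<^bsub>G\<^esub> inv\<^bsub>G\<^esub> (f v) = v \<otimes>\<^bsub>G\<^esub> inv\<^bsub>G\<^esub> u"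
          using uv a Hm by (simp add: fuv inv_mult_group)
      qed (use x in auto)
      then show ?thesis
        using x a b Hm by (simp add: f_def inv_solve_right')
    qed
    let ?\<phi> = "\<lambda>a. \<one>\<^bsub>G\<^esub> \<otimes>\<^bsub>H\<^esub> a"
    have "?\<phi> \<in> hom H G"
    proof (rule homI)
      show "?\<phi> a \<in> carrier G" if "a \<in> carrier H" for a using that Hm car by simp
      show "?\<phi> (a \<otimes>\<^bsub>H\<^esub> b) = ?\<phi> a \<otimes>\<^bsub>G\<^esub> ?\<phi> b" if "a \<in> carrier H" "b \<in> carrier H" for a b
        using that key[of "?\<phi> a" b] H.m_assoc[of "\<one>\<^bsub>G\<^esub>" a b] Hm car one_closed by simp
    qed
    moreover have "bij_betw ?\<phi> (carrier H) (carrier G)"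
    proof (rule bij_betw_imageI)
      show "inj_on ?\<phi> (carrier H)"
        using car one_closed by (auto simp: inj_on_def)
      show "?\<phi> ` carrier H = carrier G"
      proof (intro equalityI subsetI)
        fix b assume b: "b \<in> carrier G"
        let ?a = "inv\<^bsub>H\<^esub> \<one>\<^bsub>G\<^esub> \<otimes>\<^bsub>H\<^esub> b"
        have one: "\<one>\<^bsub>G\<^esub> \<in> carrier H" and bH: "b \<in> carrier H" using b car by simp_all
        have "?a \<in> carrier H" using one bH by simp
        moreover have "?\<phi> ?a = b"
          using one bH by (simp del: H.m_assoc add: H.m_assoc[symmetric])
        ultimately have "?a \<in> carrier H" "?\<phi> ?a = b" by simp_all
        then show "b \<in> ?\<phi> ` carrier H" by force
      qed (use Hm car in auto)
    qed
    ultimately show ?thesis by (auto simp: is_iso_def iso_def)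
  qed
  with G metric G_iso show ?thesis unfolding natural_group_def by blast
qed

section \<open>Calculus of repeatedly differentiable maps\<close>

lemma frechet_derivative_eqI:
  "(f has_derivative f') (at x) \<Longrightarrow> frechet_derivative f (at x) = f'"
  by (rule frechet_derivative_at[symmetric])

lemma times_differentiable_on_subset:
  "times_differentiable_on k S f \<Longrightarrow> T \<subseteq> S \<Longrightarrow> times_differentiable_on k T f"
  by (induction k arbitrary: f) (auto intro: continuous_on_subset)

lemma times_differentiable_on_cong:
  assumes "open S" "\<And>x. x \<in> S \<Longrightarrow> f x = g x" "times_differentiable_on k S f"
  shows "times_differentiable_on k S g"
  using assms(2,3)
proof (induction k arbitrary: f g)
  case 0
  then show ?case by (auto cong: continuous_on_cong)
next
  case (Suc k)
  have d: "(g has_derivative frechet_derivative f (at x)) (at x)" if "x \<in> S" for x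
    using Suc.prems that assms(1)
    by (auto simp: frechet_derivative_works intro: has_derivative_transform_within_open)
  have "times_differentiable_on k S (\<lambda>x. frechet_derivative g (at x) v)" for v
  proof (rule Suc.IH)
    show "times_differentiable_on k S (\<lambda>x. frechet_derivative f (at x) v)"
      using Suc.prems by simp
  qed (simp add: frechet_derivative_eqI[OF d])
  then show ?case using d by (auto simp: differentiable_def)
qed

text \<open>
  In practice a derivative is known in closed form; this rule avoids mentioning
  \<^const>\<open>frechet_derivative\<close>, and the closure properties below use it for their induction steps.
\<close>

lemma times_differentiable_on_SucI:
  assumes "open S" "\<And>x. x \<in> S \<Longrightarrow> (f has_derivative f' x) (at x)"
    "\<And>v. times_differentiable_on k S (\<lambda>x. f' x v)"
  shows "times_differentiable_on (Suc k) S f"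
proof -
  have "times_differentiable_on k S (\<lambda>x. frechet_derivative f (at x) v)" for v
    by (rule times_differentiable_on_cong[OF assms(1) _ assms(3)[of v]])
       (simp add: frechet_derivative_eqI[OF assms(2)])
  then show ?thesis using assms(2) by (auto simp: differentiable_def)
qed

lemma times_differentiable_on_SucD:
  assumes "times_differentiable_on (Suc k) S f"
  shows "times_differentiable_on k S f"
  using assms
proof (induction k arbitrary: f)
  case 0
  then show ?case
    by (auto intro!: continuous_at_imp_continuous_on differentiable_imp_continuous_within)
next
  case (Suc k)
  then show ?case by (metis times_differentiable_on.simps(2))
qed

lemma times_differentiable_on_local:
  assumes "\<And>x. x \<in> S \<Longrightarrow> \<exists>T. open T \<and> x \<in> T \<and> times_differentiable_on k T f"
  shows "times_differentiable_on k S f"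
  using assms
proof (induction k arbitrary: f)
  case 0
  then have "isCont f x" if "x \<in> S" for x
    using that by (metis continuous_on_eq_continuous_at times_differentiable_on.simps(1))
  then show ?case by (simp add: continuous_at_imp_continuous_on)
next
  case (Suc k)
  have "f differentiable at x" if "x \<in> S" for x using Suc.prems[OF that] by auto
  moreover have "times_differentiable_on k S (\<lambda>x. frechet_derivative f (at x) v)" for v
    by (rule Suc.IH) (use Suc.prems in fastforce)
  ultimately show ?case by simp
qed

lemma times_differentiable_on_const: "times_differentiable_on k S (\<lambda>x. c)"
  by (induction k arbitrary: c) auto

lemma (in bounded_linear) times_differentiable_on:
  assumes "open S" "times_differentiable_on k S g"
  shows "times_differentiable_on k S (\<lambda>x. f (g x))"
  using assms(2)
proof (induction k arbitrary: g)
  case 0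
  then show ?case by (auto intro: continuous_on)
next
  case (Suc k)
  show ?case
  proof (rule times_differentiable_on_SucI[OF assms(1)])
    show "((\<lambda>x. f (g x)) has_derivative (\<lambda>v. f (frechet_derivative g (at x) v))) (at x)"
      if "x \<in> S" for x
      using Suc.prems that by (intro has_derivative) (auto simp: frechet_derivative_works)
    show "times_differentiable_on k S (\<lambda>x. f (frechet_derivative g (at x) v))" for v
      by (rule Suc.IH) (use Suc.prems in auto)
  qed
qed

lemma times_differentiable_on_ident: "times_differentiable_on k S (\<lambda>x. x)"
proof (cases k)
  case (Suc n)
  then show ?thesis by (simp add: times_differentiable_on_const)
qed simp

lemma times_differentiable_on_add:
  assumes "open S" "times_differentiable_on k S f" "times_differentiable_on k S g"
  shows "times_differentiable_on k S (\<lambda>x. f x + g x)"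
  using assms(2,3)
proof (induction k arbitrary: f g)
  case 0
  then show ?case by (auto intro: continuous_intros)
next
  case (Suc k)
  show ?case
  proof (rule times_differentiable_on_SucI[OF assms(1)])
    show "((\<lambda>x. f x + g x) has_derivative
        (\<lambda>v. frechet_derivative f (at x) v + frechet_derivative g (at x) v)) (at x)"
      if "x \<in> S" for x
      using Suc.prems that by (intro has_derivative_add) (auto simp: frechet_derivative_works)
    show "times_differentiable_on k S (\<lambda>x. frechet_derivative f (at x) v + frechet_derivative g (at x) v)" for v
      by (rule Suc.IH) (use Suc.prems in auto)
  qed
qed

lemma times_differentiable_on_sum:
  assumes "open S" "\<And>i. i \<in> I \<Longrightarrow> times_differentiable_on k S (f i)"
  shows "times_differentiable_on k S (\<lambda>x. \<Sum>i\<in>I. f i x)"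
  using assms(2)
  by (induction I rule: infinite_finite_induct)
     (auto intro: times_differentiable_on_const times_differentiable_on_add[OF assms(1)])

text \<open>The Leibniz rule; the instances needed are scaling, multiplication and the inner product.\<close>

lemma (in bounded_bilinear) times_differentiable_on:
  assumes "open S" "times_differentiable_on k S f" "times_differentiable_on k S g"
  shows "times_differentiable_on k S (\<lambda>x. prod (f x) (g x))"
  using assms(2,3)
proof (induction k arbitrary: f g)
  case 0
  then show ?case by (auto intro: continuous_on)
next
  case (Suc k)
  note low = Suc.prems[THEN times_differentiable_on_SucD]
  show ?case
  proof (rule times_differentiable_on_SucI[OF assms(1)])
    show "((\<lambda>x. prod (f x) (g x)) has_derivative
        (\<lambda>v. prod (f x) (frechet_derivative g (at x) v) + prod (frechet_derivative f (at x) v) (g x))) (at x)"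
      if "x \<in> S" for x
      using Suc.prems that by (intro FDERIV) (auto simp: frechet_derivative_works)
    show "times_differentiable_on k S
      (\<lambda>x. prod (f x) (frechet_derivative g (at x) v) + prod (frechet_derivative f (at x) v) (g x))" for v
      using Suc.prems low by (intro times_differentiable_on_add assms(1) Suc.IH) auto
  qed
qed

lemma times_differentiable_on_inverse:
  fixes f :: "'e::real_normed_vector \<Rightarrow> real"
  assumes "open S" "times_differentiable_on k S f" "\<And>x. x \<in> S \<Longrightarrow> f x \<noteq> 0"
  shows "times_differentiable_on k S (\<lambda>x. inverse (f x))"
  using assms(2,3)
proof (induction k arbitrary: f)
  case 0
  then show ?case by (auto intro!: continuous_intros)
next
  case (Suc k)
  note low = Suc.IH[OF times_differentiable_on_SucD[OF Suc.prems(1)] Suc.prems(2)]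
  show ?case
  proof (rule times_differentiable_on_SucI[OF assms(1)])
    show "((\<lambda>x. inverse (f x)) has_derivative
        (\<lambda>v. - (inverse (f x) * frechet_derivative f (at x) v * inverse (f x)))) (at x)"
      if "x \<in> S" for x
      using Suc.prems that by (intro Deriv.has_derivative_inverse) (auto simp: frechet_derivative_works)
    show "times_differentiable_on k S
      (\<lambda>x. - (inverse (f x) * frechet_derivative f (at x) v * inverse (f x)))" for v
      using Suc.prems low
      by (intro bounded_linear.times_differentiable_on[OF bounded_linear_minus[OF bounded_linear_ident]]
          bounded_bilinear.times_differentiable_on[OF bounded_bilinear_mult] assms(1)) auto
  qed
qed

text \<open>
  The spanning set is orthogonal but need not be a basis: if it contains 0, the corresponding summand
  vanishes because \<open>x / 0 = 0\<close>.
\<close>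

lemma orthogonal_expansion:
  assumes "finite_dim TYPE('e::real_inner)"
  obtains C :: "'e::real_inner set" where "finite C"
    "\<And>x :: 'e::real_inner. x = (\<Sum>c\<in>C. (x \<bullet> c / (c \<bullet> c)) *\<^sub>R c)"
proof -
  obtain B :: "'e set" where "finite B" "span B = UNIV"
    using assms by (auto simp: finite_dim_def)
  then obtain C :: "'e set" where C: "finite C" "span C = UNIV" "pairwise orthogonal C"
    using basis_orthogonal[of B] by auto
  have "x = (\<Sum>c\<in>C. (x \<bullet> c / (c \<bullet> c)) *\<^sub>R c)" for x :: 'e
  proof -
    let ?z = "x - (\<Sum>c\<in>C. (x \<bullet> c / (c \<bullet> c)) *\<^sub>R c)"
    have orth: "orthogonal ?z y" for y
    proof (rule orthogonal_to_span)
      fix b assume b: "b \<in> C"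
      have "(\<Sum>c\<in>C. (x \<bullet> c / (c \<bullet> c)) *\<^sub>R c) \<bullet> b = (\<Sum>c\<in>C. if c = b then x \<bullet> b else 0)"
        unfolding inner_sum_left
        using C(3) b by (intro sum.cong) (auto simp: pairwise_def orthogonal_def)
      also have "\<dots> = x \<bullet> b" using C(1) b by simp
      finally show "orthogonal ?z b" by (simp add: orthogonal_def inner_diff_left)
    qed (use C(2) in auto)
    from orth[of ?z] have "?z = 0" by (simp only: orthogonal_self)
    then show ?thesis by simp
  qed
  with C(1) show ?thesis by (rule that)
qed

text \<open>
  In the chain rule \<open>D(g \<circ> f)(x) v = Dg(f x) (Df(x) v)\<close> the direction \<open>Df(x) v\<close> depends on \<open>x\<close>, whereas
  the induction hypothesis concerns fixed directions only. Expanding it in the orthogonal spanning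
  set \<open>C\<close> turns the derivative into a finite sum of products of maps covered by the induction hypothesis.
\<close>

lemma times_differentiable_on_compose:
  fixes f :: "'d::real_normed_vector \<Rightarrow> 'e::real_inner" and g :: "'e \<Rightarrow> 'f::real_normed_vector"
  assumes fin: "finite_dim TYPE('e)" and S: "open S" and T: "open T" and ST: "f ` S \<subseteq> T"
    and f: "times_differentiable_on k S f" and g: "times_differentiable_on k T g"
  shows "times_differentiable_on k S (\<lambda>x. g (f x))"
  using ST f g
proof (induction k arbitrary: g)
  case 0
  then show ?case by (auto intro: continuous_on_compose2)
next
  case (Suc k)
  obtain C :: "'e set" where C: "finite C" "\<And>x :: 'e. x = (\<Sum>c\<in>C. (x \<bullet> c / (c \<bullet> c)) *\<^sub>R c)"
    by (rule orthogonal_expansion[OF fin]) blast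
  define Df where "Df = (\<lambda>x v. frechet_derivative f (at x) v)"
  define Dg where "Dg = (\<lambda>x v. frechet_derivative g (at x) v)"
  have df: "(f has_derivative Df x) (at x)" if "x \<in> S" for x
    using Suc.prems(2) that by (auto simp: Df_def frechet_derivative_works)
  have dg: "(g has_derivative Dg x) (at x)" if "x \<in> T" for x
    using Suc.prems(3) that by (auto simp: Dg_def frechet_derivative_works)
  show ?case
  proof (rule times_differentiable_on_SucI[OF S])
    fix x assume x: "x \<in> S"
    then have "f x \<in> T" using Suc.prems(1) by auto
    have "((\<lambda>x. g (f x)) has_derivative (\<lambda>v. Dg (f x) (Df x v))) (at x)"
      by (rule has_derivative_compose[OF df[OF x] dg[OF \<open>f x \<in> T\<close>]])
    moreover have Dg: "Dg (f x) w = (\<Sum>c\<in>C. (w \<bullet> c / (c \<bullet> c)) *\<^sub>R Dg (f x) c)" for w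
    proof -
      have lin: "linear (Dg (f x))"
        using dg[OF \<open>f x \<in> T\<close>] by (rule has_derivative_linear)
      have "Dg (f x) w = Dg (f x) (\<Sum>c\<in>C. (w \<bullet> c / (c \<bullet> c)) *\<^sub>R c)"
        using C(2)[of w] by simp
      also have "\<dots> = (\<Sum>c\<in>C. (w \<bullet> c / (c \<bullet> c)) *\<^sub>R Dg (f x) c)"
        by (simp add: linear_sum[OF lin] linear_scale[OF lin])
      finally show ?thesis .
    qed
    ultimately show "((\<lambda>x. g (f x)) has_derivative
        (\<lambda>v. \<Sum>c\<in>C. (Df x v \<bullet> c / (c \<bullet> c)) *\<^sub>R Dg (f x) c)) (at x)"
      by (subst (asm) Dg)
  next
    fix v
    have "times_differentiable_on k S (\<lambda>x. Df x v \<bullet> c / (c \<bullet> c))" for c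
      by (rule bounded_linear.times_differentiable_on[OF _ S, where f = "\<lambda>w. w \<bullet> c / (c \<bullet> c)"])
         (use Suc.prems(2) in \<open>auto simp: Df_def
            intro: bounded_linear_compose[OF bounded_linear_divide bounded_linear_inner_left]\<close>)
    moreover have "times_differentiable_on k S (\<lambda>x. Dg (f x) c)" for c
      using Suc.prems(3)
      by (intro Suc.IH[OF Suc.prems(1) times_differentiable_on_SucD[OF Suc.prems(2)]]) (simp add: Dg_def)
    ultimately show "times_differentiable_on k S (\<lambda>x. \<Sum>c\<in>C. (Df x v \<bullet> c / (c \<bullet> c)) *\<^sub>R Dg (f x) c)"
      by (intro times_differentiable_on_sum S
          bounded_bilinear.times_differentiable_on[OF bounded_bilinear_scaleR])
  qed
qed

text \<open>
  The ball is a closed subset of the set of all linear combinations with suitably bounded coefficients, which is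
  a finite Minkowski sum of segments and hence compact.
\<close>

lemma compact_cball_if_finite_dim:
  assumes "finite_dim TYPE('e::real_inner)"
  shows "compact (cball (p::'e) r)"
proof -
  obtain C :: "'e set" where C: "finite C" "\<And>x :: 'e. x = (\<Sum>c\<in>C. (x \<bullet> c / (c \<bullet> c)) *\<^sub>R c)"
    by (rule orthogonal_expansion[OF assms]) blast
  define K where "K D = {\<Sum>c\<in>D. t c *\<^sub>R c | t. \<forall>c\<in>D. \<bar>t c\<bar> \<le> (norm p + \<bar>r\<bar>) * norm c / (c \<bullet> c)}" for D :: "'e set"
  have "compact (K D)" if "finite D" for D
    using that
  proof induction
    case empty
    then show ?case by (simp add: K_def)
  next
    case (insert a D)
    define m where "m = (norm p + \<bar>r\<bar>) * norm a / (a \<bullet> a)"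
    have seg: "compact ((\<lambda>t. t *\<^sub>R a) ` {-m..m})"
      by (intro compact_continuous_image continuous_intros) simp
    have "K (insert a D) = {x + y | x y. x \<in> (\<lambda>t. t *\<^sub>R a) ` {-m..m} \<and> y \<in> K D}"
      (is "_ = ?R")
    proof (intro equalityI subsetI)
      fix z assume "z \<in> K (insert a D)"
      then obtain t where t: "z = (\<Sum>c\<in>insert a D. t c *\<^sub>R c)"
        "\<forall>c\<in>insert a D. \<bar>t c\<bar> \<le> (norm p + \<bar>r\<bar>) * norm c / (c \<bullet> c)" by (auto simp: K_def)
      have "z = t a *\<^sub>R a + (\<Sum>c\<in>D. t c *\<^sub>R c)" using t(1) insert.hyps by simp
      moreover have "t a \<in> {-m..m}" using t(2) by (auto simp: m_def)
      moreover have "(\<Sum>c\<in>D. t c *\<^sub>R c) \<in> K D" using t(2) by (auto simp: K_def)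
      ultimately show "z \<in> ?R" by blast
    next
      fix z assume "z \<in> ?R"
      then obtain s t where st: "z = s *\<^sub>R a + (\<Sum>c\<in>D. t c *\<^sub>R c)" "\<bar>s\<bar> \<le> m"
        "\<forall>c\<in>D. \<bar>t c\<bar> \<le> (norm p + \<bar>r\<bar>) * norm c / (c \<bullet> c)"
        by (fastforce simp: K_def)
      have "(\<Sum>c\<in>D. (t(a := s)) c *\<^sub>R c) = (\<Sum>c\<in>D. t c *\<^sub>R c)"
        by (rule sum.cong) (use insert.hyps in auto)
      then have "z = (\<Sum>c\<in>insert a D. (t(a := s)) c *\<^sub>R c)" using st(1) insert.hyps by simp
      moreover have "\<forall>c\<in>insert a D. \<bar>(t(a := s)) c\<bar> \<le> (norm p + \<bar>r\<bar>) * norm c / (c \<bullet> c)"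
        using st(2,3) by (simp add: m_def)
      ultimately show "z \<in> K (insert a D)" unfolding K_def by blast
    qed
    then show ?case using compact_sums[OF seg insert.IH] by simp
  qed
  then have "compact (K C \<inter> cball p r)" using C(1) by (intro compact_Int_closed) auto
  moreover have "cball p r \<subseteq> K C"
  proof
    fix x assume "x \<in> cball p r"
    then have "norm x \<le> norm p + \<bar>r\<bar>"
      using norm_triangle_ineq2[of x p] by (simp add: dist_norm norm_minus_commute)
    then have "\<bar>x \<bullet> c / (c \<bullet> c)\<bar> \<le> (norm p + \<bar>r\<bar>) * norm c / (c \<bullet> c)" for c
      using Cauchy_Schwarz_ineq2[of x c] mult_right_mono[of "norm x" "norm p + \<bar>r\<bar>" "norm c"]
      by (simp add: abs_divide divide_right_mono)
    moreover have "x = (\<Sum>c\<in>C. (x \<bullet> c / (c \<bullet> c)) *\<^sub>R c)" by (rule C(2))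
    ultimately show "x \<in> K C"
      unfolding K_def mem_Collect_eq by (intro exI[of _ "\<lambda>c. x \<bullet> c / (c \<bullet> c)"] conjI ballI)
  qed
  ultimately show ?thesis by (simp add: Int_absorb1)
qed

lemma finite_dim_real: "finite_dim TYPE(real)"
proof -
  have "x \<in> span {1::real}" for x
    using span_scale[of "1::real" "{1}" x] by (simp add: span_base)
  then show ?thesis unfolding finite_dim_def by (intro exI[of _ "{1::real}"]) auto
qed

lemma smooth_on_subset: "smooth_on S f \<Longrightarrow> T \<subseteq> S \<Longrightarrow> smooth_on T f"
  unfolding smooth_on_def using times_differentiable_on_subset by metis

lemma smooth_on_cong:
  assumes "open S" "\<And>x. x \<in> S \<Longrightarrow> f x = g x" "smooth_on S f"
  shows "smooth_on S g"
  unfolding smooth_on_def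
proof
  show "times_differentiable_on k S g" for k
    by (rule times_differentiable_on_cong[OF assms(1,2)]) (use assms(3) in \<open>simp_all add: smooth_on_def\<close>)
qed

lemma smooth_on_local:
  assumes "\<And>x. x \<in> S \<Longrightarrow> \<exists>T. open T \<and> x \<in> T \<and> smooth_on T f"
  shows "smooth_on S f"
  unfolding smooth_on_def
proof
  show "times_differentiable_on k S f" for k
    by (rule times_differentiable_on_local) (use assms in \<open>auto simp: smooth_on_def\<close>)
qed

lemma smooth_on_imp_continuous_on: "smooth_on S f \<Longrightarrow> continuous_on S f"
  unfolding smooth_on_def by (metis times_differentiable_on.simps(1))

lemma smooth_on_const: "smooth_on S (\<lambda>x. c)"
  by (simp add: smooth_on_def times_differentiable_on_const)

lemma smooth_on_ident: "smooth_on S (\<lambda>x. x)"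
  by (simp add: smooth_on_def times_differentiable_on_ident)

lemma smooth_on_compose:
  fixes f :: "'d::real_normed_vector \<Rightarrow> 'e::real_inner"
  assumes "finite_dim TYPE('e)" "open S" "open T" "f ` S \<subseteq> T" "smooth_on S f" "smooth_on T g"
  shows "smooth_on S (g \<circ> f)"
  unfolding smooth_on_def comp_def
proof
  show "times_differentiable_on k S (\<lambda>x. g (f x))" for k
    by (rule times_differentiable_on_compose[OF assms(1-4)])
       (use assms(5,6) in \<open>simp_all add: smooth_on_def\<close>)
qed

section \<open>A compactly supported diffeomorphism of a vector space\<close>

text \<open>
  For \<open>P = 1\<close> this is the standard smooth function that is flat at 0. Admitting all polynomials \<open>P\<close> makes
  the family closed under differentiation, so that smoothness is a plain induction.
\<close>

definition flat_exp :: "real poly \<Rightarrow> real \<Rightarrow> real" where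
  "flat_exp P t = (if 0 < t then poly P (1 / t) * exp (- (1 / t)) else 0)"

lemma poly_times_exp_minus_tendsto_0:
  fixes P :: "real poly"
  shows "((\<lambda>u. poly P u * exp (- u)) \<longlongrightarrow> 0) at_top"
proof -
  have "((\<lambda>u. \<Sum>i\<le>degree P. coeff P i * (u ^ i / exp u)) \<longlongrightarrow> (\<Sum>i\<le>degree P. coeff P i * 0)) at_top"
    by (intro tendsto_intros tendsto_power_div_exp_0)
  then show ?thesis
    by (simp add: poly_altdef sum_distrib_right exp_minus divide_inverse mult.assoc)
qed

text \<open>
  With \<open>u = 1 / t\<close>, the derivative of \<open>P u exp (- u)\<close> is \<open>u\<^sup>2 (P u - P' u) exp (- u)\<close>. At 0, the difference
  quotient from the right is \<open>u P u exp (- u)\<close> with \<open>u\<close> tending to infinity.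
\<close>

lemma flat_exp_has_derivative:
  "(flat_exp P has_real_derivative flat_exp (monom 1 2 * (P - pderiv P)) t) (at t)"
proof (cases t "0::real" rule: linorder_cases)
  case less
  have "((\<lambda>_. 0) has_real_derivative 0) (at t)" by simp
  then have "(flat_exp P has_real_derivative 0) (at t)"
    by (rule has_field_derivative_transform_within_open[where S = "{..<0}"])
       (use less in \<open>auto simp: flat_exp_def\<close>)
  then show ?thesis using less by (simp add: flat_exp_def)
next
  case greater
  have "((\<lambda>t. poly P (1 / t) * exp (- (1 / t))) has_real_derivative
      flat_exp (monom 1 2 * (P - pderiv P)) t) (at t)"
    using greater
    by (auto intro!: derivative_eq_intros DERIV_chain2[OF poly_DERIV]
        simp: flat_exp_def poly_monom field_simps power2_eq_square)
  then show ?thesis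
    by (rule has_field_derivative_transform_within_open[where S = "{0<..}"])
       (use greater in \<open>auto simp: flat_exp_def\<close>)
next
  case equal
  have "((\<lambda>y. flat_exp P y / y) \<longlongrightarrow> 0) (at_left 0)"
    by (rule tendsto_eventually) (auto simp: flat_exp_def eventually_at_filter)
  moreover have "((\<lambda>y. flat_exp P y / y) \<longlongrightarrow> 0) (at_right 0)"
    unfolding filterlim_at_right_to_top
  proof (rule Lim_transform_eventually)
    show "((\<lambda>u. poly (monom 1 1 * P) u * exp (- u)) \<longlongrightarrow> 0) at_top"
      by (rule poly_times_exp_minus_tendsto_0)
    show "\<forall>\<^sub>F u in at_top. poly (monom 1 1 * P) u * exp (- u) = flat_exp P (inverse u) / inverse u"
      using eventually_gt_at_top[of "0::real"]
      by eventually_elim (simp add: flat_exp_def poly_monom field_simps)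
  qed
  ultimately have "((\<lambda>y. flat_exp P y / y) \<longlongrightarrow> 0) (at 0)" by (rule filterlim_split_at)
  then show ?thesis
    using equal by (simp add: has_field_derivative_iff flat_exp_def)
qed

lemma times_differentiable_on_flat_exp: "times_differentiable_on k UNIV (flat_exp P)"
proof (induction k arbitrary: P)
  case 0
  show ?case
    by (auto intro!: continuous_at_imp_continuous_on DERIV_isCont[OF flat_exp_has_derivative])
next
  case (Suc k)
  show ?case
  proof (rule times_differentiable_on_SucI)
    show "(flat_exp P has_derivative (\<lambda>v. flat_exp (monom 1 2 * (P - pderiv P)) x * v)) (at x)" for x
      using flat_exp_has_derivative[of P x] by (simp add: has_field_derivative_def)
    show "times_differentiable_on k UNIV (\<lambda>x. flat_exp (monom 1 2 * (P - pderiv P)) x * v)" for v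
      by (intro bounded_linear.times_differentiable_on[OF bounded_linear_mult_left] Suc.IH) simp
  qed simp
qed

lemma flat_exp_1_bounds: "0 \<le> flat_exp 1 t" "flat_exp 1 t \<le> 1" "0 < flat_exp 1 t \<longleftrightarrow> 0 < t"
  by (auto simp: flat_exp_def)

text \<open>The derivative is \<open>u\<^sup>2 exp (- u)\<close> with \<open>u = 1 / t\<close>, which is at most 2 as \<open>exp u \<ge> u\<^sup>2 / 2\<close>.\<close>

lemma flat_exp_1_lipschitz: "\<bar>flat_exp 1 a - flat_exp 1 b\<bar> \<le> 2 * \<bar>a - b\<bar>"
proof -
  have bound: "norm (flat_exp (monom 1 2 * (1 - pderiv 1)) t) \<le> 2" for t
  proof (cases "0 < t")
    case True
    define u where "u = 1 / t"
    have "0 < u" using True by (simp add: u_def)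
    then have "u\<^sup>2 / 2 \<le> exp u"
      using exp_lower_Taylor_quadratic[of u] by linarith
    then have "u\<^sup>2 * exp (- u) \<le> 2" by (simp add: exp_minus field_simps)
    then show ?thesis using True by (simp add: flat_exp_def poly_monom u_def)
  qed (simp add: flat_exp_def)
  have "norm (flat_exp 1 a - flat_exp 1 b) \<le> 2 * norm (a - b)"
    by (rule field_differentiable_bound[of UNIV, OF _ flat_exp_has_derivative bound]) auto
  then show ?thesis by simp
qed

definition bump :: "'e::real_inner \<Rightarrow> real \<Rightarrow> 'e \<Rightarrow> real" where
  "bump p r x = flat_exp 1 (r\<^sup>2 - (x - p) \<bullet> (x - p))"

lemma bump_bounds: "0 \<le> bump p r x" "bump p r x \<le> 1"
  by (simp_all add: bump_def flat_exp_1_bounds)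

lemma bump_pos_iff: "0 < r \<Longrightarrow> 0 < bump p r x \<longleftrightarrow> dist p x < r"
  unfolding bump_def flat_exp_1_bounds(3) power2_norm_eq_inner[symmetric]
  by (simp add: dist_norm norm_minus_commute power_mono_iff flip: not_le)

lemma smooth_on_bump: "smooth_on UNIV (bump (p :: 'e::real_inner) r)"
  unfolding smooth_on_def
proof
  fix k
  have shift: "times_differentiable_on k UNIV (\<lambda>x :: 'e. x + (- p))"
    by (intro times_differentiable_on_add times_differentiable_on_ident times_differentiable_on_const) simp
  have "times_differentiable_on k UNIV (\<lambda>x. (x + (- p)) \<bullet> (x + (- p)))"
    by (intro bounded_bilinear.times_differentiable_on[OF bounded_bilinear_inner] shift) simp
  then have "times_differentiable_on k UNIV (\<lambda>x. r\<^sup>2 + (- ((x + (- p)) \<bullet> (x + (- p)))))"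
    by (intro times_differentiable_on_add times_differentiable_on_const
        bounded_linear.times_differentiable_on[OF bounded_linear_minus[OF bounded_linear_ident]]) auto
  then have "times_differentiable_on k UNIV (\<lambda>x. r\<^sup>2 - (x - p) \<bullet> (x - p))" by simp
  then show "times_differentiable_on k UNIV (bump p r)"
    unfolding bump_def
    by (rule times_differentiable_on_compose[OF finite_dim_real open_UNIV open_UNIV subset_UNIV _
        times_differentiable_on_flat_exp])
qed

text \<open>
  Squared distances are Lipschitz only on bounded sets, but truncating the distance at \<open>r\<close> does not
  change the bump function.
\<close>

lemma bump_lipschitz:
  assumes "0 < r"
  shows "\<bar>bump p r x - bump p r y\<bar> \<le> 4 * r * norm (x - y)"
proof -
  define m where "m x = min (norm (x - p)) r" for x
  have eq: "bump p r x = flat_exp 1 (r\<^sup>2 - (m x)\<^sup>2)" for x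
  proof (cases "norm (x - p) < r")
    case True
    then show ?thesis by (simp add: bump_def m_def power2_norm_eq_inner min_def)
  next
    case False
    then have "r\<^sup>2 \<le> (norm (x - p))\<^sup>2" using assms by (intro power_mono) auto
    then show ?thesis
      using False by (simp add: bump_def m_def flat_exp_def min_def power2_norm_eq_inner)
  qed
  have m: "0 \<le> m x" "m x \<le> r" for x using assms by (auto simp: m_def)
  have "\<bar>bump p r x - bump p r y\<bar> \<le> 2 * \<bar>(m y)\<^sup>2 - (m x)\<^sup>2\<bar>"
    using flat_exp_1_lipschitz[of "r\<^sup>2 - (m x)\<^sup>2" "r\<^sup>2 - (m y)\<^sup>2"] by (simp add: eq)
  also have "\<dots> = 2 * (\<bar>m y - m x\<bar> * \<bar>m y + m x\<bar>)"
    by (simp add: power2_eq_square abs_mult[symmetric] algebra_simps)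
  also have "\<dots> \<le> 2 * (norm (x - y) * (2 * r))"
  proof -
    have "\<bar>norm (y - p) - norm (x - p)\<bar> \<le> norm (x - y)"
      using norm_triangle_ineq3[of "y - p" "x - p"] by (simp add: norm_minus_commute)
    then have "\<bar>m y - m x\<bar> \<le> norm (x - y)" by (auto simp: m_def min_def)
    moreover have "\<bar>m y + m x\<bar> \<le> 2 * r" using m[of x] m[of y] by simp
    ultimately show ?thesis by (intro mult_left_mono mult_mono) auto
  qed
  finally show ?thesis by (simp add: mult_ac)
qed

lemma has_derivative_lipschitz_bound:
  fixes f :: "'e::real_normed_vector \<Rightarrow> real"
  assumes lip: "\<And>x y. \<bar>f x - f y\<bar> \<le> L * norm (x - y)"
    and der: "(f has_derivative f') (at x)"
  shows "\<bar>f' v\<bar> \<le> L * norm v"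
proof -
  have "((\<lambda>t :: real. x + t *\<^sub>R v) has_derivative (\<lambda>t. t *\<^sub>R v)) (at 0)"
    by (auto intro!: derivative_eq_intros)
  moreover have "(f has_derivative f') (at (x + 0 *\<^sub>R v))" using der by simp
  ultimately have "((\<lambda>t. f (x + t *\<^sub>R v)) has_derivative (\<lambda>t. f' (t *\<^sub>R v))) (at 0)"
    by (rule has_derivative_compose)
  then have "((\<lambda>t. f (x + t *\<^sub>R v)) has_real_derivative f' v) (at 0)"
    by (simp add: has_field_derivative_def linear_scale[OF has_derivative_linear[OF der]]
        mult_commute_abs)
  then have "((\<lambda>t. \<bar>(f (x + t *\<^sub>R v) - f x) / t\<bar>) \<longlongrightarrow> \<bar>f' v\<bar>) (at 0)"
    by (intro tendsto_rabs) (simp add: has_field_derivative_iff)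
  moreover have "\<bar>(f (x + t *\<^sub>R v) - f x) / t\<bar> \<le> L * norm v" if "t \<noteq> 0" for t
    using lip[of "x + t *\<^sub>R v" x] that by (simp add: abs_divide divide_le_eq mult_ac)
  ultimately show ?thesis
    by (intro tendsto_upperbound[where F = "at (0::real)"]) (auto simp: eventually_at_filter)
qed

text \<open>
  The map \<open>F x = x + g x v\<close> preserves the lines in direction \<open>v\<close>, on which it is onto by the
  intermediate value theorem, and it shrinks distances by at most a factor 2, so that it has a
  Lipschitz inverse \<open>h\<close>. The derivative of \<open>F\<close> at \<open>x\<close> is a rank one perturbation of the identity, with the
  explicit inverse \<open>w \<mapsto> w - (Dg(x) w / (1 + Dg(x) v)) v\<close>. Hence the derivative of \<open>h\<close> is a smooth
  function of \<open>h\<close>, and \<open>h\<close> gains one order of differentiability after the other.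
\<close>

lemma directional_perturbation_diffeomorphism:
  fixes g :: "'e::real_inner \<Rightarrow> real" and v :: 'e
  assumes fin: "finite_dim TYPE('e)" and smooth: "smooth_on UNIV g"
    and lip: "\<And>x y. \<bar>g x - g y\<bar> \<le> 1/2 * norm (x - y)"
    and bounds: "\<And>x. 0 \<le> g x" "\<And>x. g x \<le> 1" and v: "norm v = 1"
  obtains h where "smooth_on UNIV (\<lambda>x. x + g x *\<^sub>R v)" "smooth_on UNIV h"
    "\<And>x. h (x + g x *\<^sub>R v) = x" "\<And>y. h y + g (h y) *\<^sub>R v = y"
proof -
  define F where "F x = x + g x *\<^sub>R v" for x
  have smooth_scaleR: "times_differentiable_on k UNIV (\<lambda>x. q x *\<^sub>R v)"
    if "times_differentiable_on k UNIV q" for k and q :: "'e \<Rightarrow> real"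
    using that by (intro bounded_linear.times_differentiable_on[OF bounded_linear_scaleR_left]) auto
  have smooth_F: "smooth_on UNIV F"
    using smooth unfolding smooth_on_def F_def
    by (auto intro!: times_differentiable_on_add times_differentiable_on_ident smooth_scaleR)
  have expand: "norm (x - y) \<le> 2 * norm (F x - F y)" for x y
  proof -
    have "x - y = (F x - F y) - (g x - g y) *\<^sub>R v" by (simp add: F_def algebra_simps)
    then have "norm (x - y) \<le> norm (F x - F y) + norm ((g x - g y) *\<^sub>R v)"
      by (metis norm_triangle_ineq4)
    also have "norm ((g x - g y) *\<^sub>R v) \<le> 1/2 * norm (x - y)" using lip[of x y] v by simp
    finally show ?thesis by simp
  qed
  have cont_g: "continuous_on UNIV g"
    using smooth by (metis smooth_on_def times_differentiable_on.simps(1))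
  \<comment> \<open>\<open>g\<close> has values between 0 and 1, so a preimage of \<open>y\<close> lies on the segment from \<open>y - v\<close> to \<open>y\<close>\<close>
  have "\<exists>x. F x = y" for y
  proof -
    have "\<exists>t\<ge>-1. t \<le> 0 \<and> t + g (y + t *\<^sub>R v) = 0"
    proof (rule IVT')
      show "- 1 + g (y + (- 1) *\<^sub>R v) \<le> 0" using bounds(2)[of "y + (- 1) *\<^sub>R v"] by simp
      show "0 \<le> 0 + g (y + 0 *\<^sub>R v)" using bounds(1) by simp
      show "continuous_on {-1..0} (\<lambda>t. t + g (y + t *\<^sub>R v))"
        by (intro continuous_intros continuous_on_compose2[OF cont_g]) auto
    qed simp
    then obtain t where "t + g (y + t *\<^sub>R v) = 0" by blast
    then have "F (y + t *\<^sub>R v) = y" by (simp add: F_def scaleR_add_left[symmetric] add.assoc)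
    then show ?thesis by blast
  qed
  then obtain h where Fh: "\<And>y. F (h y) = y" by metis
  have hF: "h (F x) = x" for x using expand[of "h (F x)" x] by (simp add: Fh)
  have "dist (h x) (h y) \<le> 2 * dist x y" for x y
    using expand[of "h x" "h y"] by (simp add: Fh dist_norm)
  then have lip_h: "2-lipschitz_on UNIV h" by (intro lipschitz_onI) auto
  define Dg where "Dg x = frechet_derivative g (at x)" for x
  have smooth_Suc: "times_differentiable_on (Suc k) UNIV g" for k
    using smooth unfolding smooth_on_def by blast
  have dg: "(g has_derivative Dg x) (at x)" for x
    using smooth_Suc[of 0] by (simp add: Dg_def frechet_derivative_works)
  have smooth_Dg: "times_differentiable_on k UNIV (\<lambda>x. Dg x w)" for k w
    using smooth_Suc[of k] by (simp add: Dg_def)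
  have pos: "1 + Dg x v \<noteq> 0" for x
    using has_derivative_lipschitz_bound[OF lip dg[of x], of v] v by auto
  define Dh where "Dh y w = w + (- (Dg (h y) w * inverse (1 + Dg (h y) v))) *\<^sub>R v" for y w
  have dh: "(h has_derivative Dh y) (at y)" for y
  proof (rule has_derivative_inverse_basic[where f = F and T = UNIV])
    let ?x = "h y"
    interpret D: bounded_linear "Dg ?x" using dg by (rule has_derivative_bounded_linear)
    show "(F has_derivative (\<lambda>u. u + Dg ?x u *\<^sub>R v)) (at ?x)"
      unfolding F_def by (auto intro!: derivative_eq_intros dg)
    show "bounded_linear (Dh y)"
      unfolding Dh_def
      by (intro bounded_linear_add bounded_linear_ident bounded_linear_scaleR_const
          bounded_linear_minus bounded_linear_mult_const D.bounded_linear_axioms)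
    show "Dh y \<circ> (\<lambda>u. u + Dg ?x u *\<^sub>R v) = id"
    proof
      fix u
      have "Dg ?x (u + Dg ?x u *\<^sub>R v) * inverse (1 + Dg ?x v) = Dg ?x u"
        using pos[of ?x] by (simp add: D.add D.scaleR field_simps)
      then show "(Dh y \<circ> (\<lambda>u. u + Dg ?x u *\<^sub>R v)) u = id u"
        by (simp add: Dh_def)
    qed
    show "continuous (at y) h"
      using lipschitz_on_continuous_on[OF lip_h] by (simp add: continuous_on_eq_continuous_at)
  qed (simp_all add: Fh)
  have smooth_h: "times_differentiable_on k UNIV h" for k
  proof (induction k)
    case 0
    then show ?case using lipschitz_on_continuous_on[OF lip_h] by simp
  next
    case (Suc k)
    show ?case
    proof (rule times_differentiable_on_SucI[OF open_UNIV dh])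
      fix w
      have "times_differentiable_on k UNIV (\<lambda>x. - (Dg x w * inverse (1 + Dg x v)))"
        using pos
        by (intro bounded_linear.times_differentiable_on[OF bounded_linear_minus[OF bounded_linear_ident]]
            bounded_bilinear.times_differentiable_on[OF bounded_bilinear_mult]
            times_differentiable_on_inverse times_differentiable_on_add
            times_differentiable_on_const smooth_Dg) auto
      from times_differentiable_on_compose[OF fin open_UNIV open_UNIV subset_UNIV Suc.IH this]
      show "times_differentiable_on k UNIV (\<lambda>y. Dh y w)"
        unfolding Dh_def
        by (intro times_differentiable_on_add times_differentiable_on_const smooth_scaleR) auto
    qed
  qed
  show ?thesis
  proof (rule that)
    show "smooth_on UNIV (\<lambda>x. x + g x *\<^sub>R v)" using smooth_F by (simp add: F_def[abs_def])
    show "smooth_on UNIV h" using smooth_h by (simp add: smooth_on_def)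
  qed (use Fh hF in \<open>simp_all add: F_def\<close>)
qed

lemma compactly_supported_diffeomorphism:
  fixes p :: "'e::real_inner"
  assumes fin: "finite_dim TYPE('e)" and nontriv: "\<exists>v::'e. v \<noteq> 0" and r: "0 < r"
  obtains F h where "smooth_on UNIV F" "smooth_on UNIV h"
    "h \<circ> F = id" "F \<circ> h = id" "F p \<noteq> p" "{x. F x \<noteq> x} \<subseteq> cball p r"
proof -
  obtain w :: 'e where "w \<noteq> 0" using nontriv by blast
  define v where "v = w /\<^sub>R norm w"
  have v: "norm v = 1" using \<open>w \<noteq> 0\<close> by (simp add: v_def)
  \<comment> \<open>the bump of radius \<open>s \<le> 1\<close> is 4-Lipschitz, so a factor 1/8 brings the constant down to 1/2\<close>
  define s where "s = min r 1"
  have s: "0 < s" "s \<le> r" "s \<le> 1" using r by (auto simp: s_def)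
  define g where "g x = bump p s x / 8" for x
  have "smooth_on UNIV g"
    using smooth_on_bump[of p s] unfolding smooth_on_def g_def
    by (auto intro: bounded_linear.times_differentiable_on[OF bounded_linear_divide])
  moreover have "\<bar>g x - g y\<bar> \<le> 1/2 * norm (x - y)" for x y
  proof -
    have "\<bar>g x - g y\<bar> = \<bar>bump p s x - bump p s y\<bar> / 8" by (simp add: g_def diff_divide_distrib[symmetric])
    also have "\<dots> \<le> 4 * s * norm (x - y) / 8"
      by (intro divide_right_mono bump_lipschitz s) simp
    also have "\<dots> \<le> 4 * 1 * norm (x - y) / 8"
      by (intro divide_right_mono mult_right_mono mult_left_mono s) auto
    finally show ?thesis by simp
  qed
  moreover have "0 \<le> g x" "g x \<le> 1" for x
    using bump_bounds[where p = p and r = s and x = x] by (auto simp: g_def)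
  ultimately obtain h where h: "smooth_on UNIV (\<lambda>x. x + g x *\<^sub>R v)" "smooth_on UNIV h"
    "\<And>x. h (x + g x *\<^sub>R v) = x" "\<And>y. h y + g (h y) *\<^sub>R v = y"
    by (rule directional_perturbation_diffeomorphism[OF fin _ _ _ _ v]) blast
  show ?thesis
  proof (rule that)
    show "smooth_on UNIV (\<lambda>x. x + g x *\<^sub>R v)" "smooth_on UNIV h" by (fact h)+
    show "h \<circ> (\<lambda>x. x + g x *\<^sub>R v) = id" "(\<lambda>x. x + g x *\<^sub>R v) \<circ> h = id"
      using h(3,4) by auto
    have "0 < g p" using bump_pos_iff[OF s(1), of p p] s by (simp add: g_def)
    then show "p + g p *\<^sub>R v \<noteq> p" using v by auto
    have "g x = 0" if "x \<notin> cball p r" for x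
    proof -
      have "\<not> 0 < bump p s x" using that s by (simp add: bump_pos_iff)
      then show ?thesis using bump_bounds(1)[of p s x] by (simp add: g_def)
    qed
    then show "{x. x + g x *\<^sub>R v \<noteq> x} \<subseteq> cball p r" by force
  qed
qed

section \<open>Charts and smooth maps\<close>

lemma smooth_manifold_finite_dim:
  fixes A :: "('a, 'e::real_inner) chart set"
  shows "smooth_manifold X A \<Longrightarrow> finite_dim TYPE('e)"
  by (simp add: smooth_manifold_def)

lemma chart_at:
  assumes "smooth_manifold X A" "x \<in> topspace X"
  obtains U \<phi> where "(U, \<phi>) \<in> A" "x \<in> U"
proof -
  have "x \<in> (\<Union>(U, \<phi>)\<in>A. U)"
    using assms by (auto simp: smooth_manifold_def smooth_atlas_def)
  then show ?thesis using that by auto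
qed

lemma chart_homeomorphic:
  assumes "smooth_manifold X A" "(U, \<phi>) \<in> A"
  shows chart_domain_open: "openin X U" and chart_image_open: "open (\<phi> ` U)"
    and chart_homeomorphic_map: "homeomorphic_map (subtopology X U) (top_of_set (\<phi> ` U)) \<phi>"
  using assms by (auto simp: smooth_manifold_def smooth_atlas_def is_chart_def)

lemma chart_subset_topspace:
  "smooth_manifold X A \<Longrightarrow> (U, \<phi>) \<in> A \<Longrightarrow> U \<subseteq> topspace X"
  using chart_domain_open openin_subset by blast

lemma chart_inj:
  assumes "smooth_manifold X A" "(U, \<phi>) \<in> A"
  shows "inj_on \<phi> U"
  using chart_homeomorphic_map[OF assms] chart_subset_topspace[OF assms]
  by (simp add: homeomorphic_eq_everything_map Int_absorb1)

lemma chart_inv_into: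
  assumes "smooth_manifold X A" "(U, \<phi>) \<in> A" "x \<in> U"
  shows "inv_into U \<phi> (\<phi> x) = x"
  using chart_inj[OF assms(1,2)] assms(3) by simp

lemma chart_open_image:
  assumes M: "smooth_manifold X A" "(U, \<phi>) \<in> A" and N: "openin X N" "N \<subseteq> U"
  shows "open (\<phi> ` N)"
proof -
  have "openin (subtopology X U) N"
    using N chart_domain_open[OF M] by (simp add: openin_open_subtopology)
  then have "openin (top_of_set (\<phi> ` U)) (\<phi> ` N)"
    using homeomorphic_imp_open_map[OF chart_homeomorphic_map[OF M]] by (simp add: open_map_def)
  then show ?thesis using chart_image_open[OF M] openin_open_trans by blast
qed

lemma chart_open_vimage:
  assumes M: "smooth_manifold X A" "(U, \<phi>) \<in> A" and P: "open P"
  shows "openin X {x \<in> U. \<phi> x \<in> P}"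
proof -
  have "openin (top_of_set (\<phi> ` U)) (\<phi> ` U \<inter> P)"
    using P by (rule openin_open_Int)
  then have "openin (subtopology X U) {x \<in> topspace (subtopology X U). \<phi> x \<in> \<phi> ` U \<inter> P}"
    using homeomorphic_imp_continuous_map[OF chart_homeomorphic_map[OF M]]
    by (rule openin_continuous_map_preimage[rotated])
  moreover have "{x \<in> topspace (subtopology X U). \<phi> x \<in> \<phi> ` U \<inter> P} = {x \<in> U. \<phi> x \<in> P}"
    using chart_subset_topspace[OF M] by auto
  ultimately show ?thesis
    using chart_domain_open[OF M] by (simp add: openin_open_subtopology)
qed

lemma transition_map:
  assumes "smooth_manifold X A" "(U, \<phi>) \<in> A" "(V, \<psi>) \<in> A"
  shows transition_map_smooth: "smooth_on (\<phi> ` (U \<inter> V)) (\<psi> \<circ> inv_into U \<phi>)"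
    and transition_domain_open: "open (\<phi> ` (U \<inter> V))"
proof -
  show "smooth_on (\<phi> ` (U \<inter> V)) (\<psi> \<circ> inv_into U \<phi>)"
    using assms by (fastforce simp: smooth_manifold_def smooth_atlas_def)
  show "open (\<phi> ` (U \<inter> V))"
    using chart_domain_open[OF assms(1,2)] chart_domain_open[OF assms(1,3)]
    by (intro chart_open_image[OF assms(1,2)]) auto
qed

text \<open>
  Smoothness has to be checked in one pair of charts around each point only, since any other
  representation differs by transition maps. Continuity follows as well, because charts are
  homeomorphisms.
\<close>

lemma smooth_mapI_local:
  fixes A :: "('a, 'e::real_inner) chart set" and B :: "('b, 'f::real_inner) chart set"
  assumes M: "smooth_manifold X A" and M': "smooth_manifold Y B"
    and loc: "\<And>x. x \<in> topspace X \<Longrightarrow> \<exists>U \<phi> V \<psi> N. (U, \<phi>) \<in> A \<and> (V, \<psi>) \<in> B \<and>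
      openin X N \<and> x \<in> N \<and> N \<subseteq> U \<and> f ` N \<subseteq> V \<and> smooth_on (\<phi> ` N) (\<psi> \<circ> f \<circ> inv_into U \<phi>)"
  shows "smooth_map X A Y B f"
proof -
  have f_in: "f x \<in> topspace Y" if "x \<in> topspace X" for x
    using loc[OF that] chart_subset_topspace[OF M'] by blast
  have nbhd: "\<exists>T. openin X T \<and> x \<in> T \<and> f ` T \<subseteq> W" if x: "x \<in> topspace X" and W: "openin Y W" "f x \<in> W" for x W
  proof -
    obtain U \<phi> V \<psi> N where c: "(U, \<phi>) \<in> A" "(V, \<psi>) \<in> B" "openin X N" "x \<in> N" "N \<subseteq> U" "f ` N \<subseteq> V"
      "smooth_on (\<phi> ` N) (\<psi> \<circ> f \<circ> inv_into U \<phi>)" using loc[OF x] by blast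
    have opN: "open (\<phi> ` N)" by (rule chart_open_image[OF M c(1,3,5)])
    have opW: "open (\<psi> ` (V \<inter> W))"
      using chart_domain_open[OF M' c(2)] W by (intro chart_open_image[OF M' c(2)]) auto
    define P where "P = \<phi> ` N \<inter> (\<psi> \<circ> f \<circ> inv_into U \<phi>) -` (\<psi> ` (V \<inter> W))"
    have "open P"
      unfolding P_def using smooth_on_imp_continuous_on[OF c(7)] opN opW
      by (rule continuous_open_preimage)
    define T where "T = N \<inter> {y \<in> U. \<phi> y \<in> P}"
    have "openin X T" unfolding T_def by (intro openin_Int c chart_open_vimage[OF M c(1) \<open>open P\<close>])
    moreover have "x \<in> T"
    proof -
      have "x \<in> U" "f x \<in> V" using c by auto
      then show ?thesis using c(4) W chart_inv_into[OF M c(1)] by (auto simp: T_def P_def)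
    qed
    moreover have "f y \<in> W" if "y \<in> T" for y
    proof -
      have y: "y \<in> N" "y \<in> U" "\<phi> y \<in> P" using that by (auto simp: T_def)
      then have "\<psi> (f (inv_into U \<phi> (\<phi> y))) \<in> \<psi> ` (V \<inter> W)" by (simp add: P_def)
      then have "\<psi> (f y) \<in> \<psi> ` (V \<inter> W)" using y(2) by (simp add: chart_inv_into[OF M c(1)])
      moreover have "f y \<in> V" using y(1) c(6) by blast
      ultimately show ?thesis using chart_inj[OF M' c(2)] by (auto dest: inj_onD)
    qed
    ultimately show ?thesis by blast
  qed
  have cont: "continuous_map X Y f"
    unfolding continuous_map_def
  proof (intro conjI allI impI)
    fix W assume W: "openin Y W"
    show "openin X {x \<in> topspace X. f x \<in> W}"
    proof (subst openin_subopen, intro ballI)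
      fix x assume "x \<in> {x \<in> topspace X. f x \<in> W}"
      then obtain T where T: "openin X T" "x \<in> T" "f ` T \<subseteq> W" using nbhd[OF _ W] by blast
      then have "T \<subseteq> {x \<in> topspace X. f x \<in> W}" using openin_subset[OF T(1)] by blast
      then show "\<exists>T. openin X T \<and> x \<in> T \<and> T \<subseteq> {x \<in> topspace X. f x \<in> W}" using T by blast
    qed
  qed (use f_in in auto)
  have "smooth_on (\<phi>' ` {x \<in> U'. f x \<in> V'}) (\<psi>' \<circ> f \<circ> inv_into U' \<phi>')"
    if U': "(U', \<phi>') \<in> A" and V': "(V', \<psi>') \<in> B" for U' \<phi>' V' \<psi>'
  proof (rule smooth_on_local)
    fix z assume "z \<in> \<phi>' ` {x \<in> U'. f x \<in> V'}"
    then obtain x where x: "x \<in> U'" "f x \<in> V'" "z = \<phi>' x" by blast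
    then have "x \<in> topspace X" using chart_subset_topspace[OF M U'] by blast
    then obtain U \<phi> V \<psi> N where c: "(U, \<phi>) \<in> A" "(V, \<psi>) \<in> B" "openin X N" "x \<in> N" "N \<subseteq> U" "f ` N \<subseteq> V"
      "smooth_on (\<phi> ` N) (\<psi> \<circ> f \<circ> inv_into U \<phi>)" using loc by blast
    define N' where "N' = {y \<in> N \<inter> U'. f y \<in> V'}"
    have "N' = (N \<inter> U') \<inter> {y \<in> topspace X. f y \<in> V'}"
      using chart_subset_topspace[OF M U'] by (auto simp: N'_def)
    then have opN': "openin X N'"
      using cont chart_domain_open[OF M' V'] chart_domain_open[OF M U'] c(3)
      by (auto intro: openin_continuous_map_preimage)
    have sub: "N' \<subseteq> U" "N' \<subseteq> U'" "N' \<subseteq> N" using c(5) by (auto simp: N'_def)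
    have T: "open (\<phi>' ` N')" "open (\<phi> ` N')"
      by (rule chart_open_image[OF M _ opN']; use U' c(1) sub in blast)+
    have inv: "inv_into U \<phi> (\<phi> y) = y" "inv_into U' \<phi>' (\<phi>' y) = y" if "y \<in> N'" for y
      using that sub chart_inv_into[OF M] c(1) U' by blast+
    have inv_V: "inv_into V \<psi> (\<psi> (f y)) = f y" if "y \<in> N'" for y
      using that sub c(6) chart_inv_into[OF M' c(2)] by blast
    have 1: "smooth_on (\<phi>' ` N') (\<phi> \<circ> inv_into U' \<phi>')"
      using transition_map_smooth[OF M U' c(1)] by (rule smooth_on_subset) (use sub in blast)
    have 2: "smooth_on (\<phi> ` N') (\<psi> \<circ> f \<circ> inv_into U \<phi>)"
      using c(7) by (rule smooth_on_subset) (use sub in blast)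
    have 3: "smooth_on (\<psi> ` (V \<inter> V')) (\<psi>' \<circ> inv_into V \<psi>)"
      by (rule transition_map_smooth[OF M' c(2) V'])
    have 23: "smooth_on (\<phi> ` N') ((\<psi>' \<circ> inv_into V \<psi>) \<circ> (\<psi> \<circ> f \<circ> inv_into U \<phi>))"
      by (rule smooth_on_compose[OF smooth_manifold_finite_dim[OF M'] T(2)
            transition_domain_open[OF M' c(2) V'] _ 2 3])
         (use c(6) inv sub in \<open>auto simp: N'_def\<close>)
    have "smooth_on (\<phi>' ` N') (((\<psi>' \<circ> inv_into V \<psi>) \<circ> (\<psi> \<circ> f \<circ> inv_into U \<phi>)) \<circ> (\<phi> \<circ> inv_into U' \<phi>'))"
      by (rule smooth_on_compose[OF smooth_manifold_finite_dim[OF M] T(1) T(2) _ 1 23])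
         (use inv in auto)
    then have "smooth_on (\<phi>' ` N') (\<psi>' \<circ> f \<circ> inv_into U' \<phi>')"
      by (rule smooth_on_cong[OF T(1), rotated]) (use inv inv_V in auto)
    moreover have "z \<in> \<phi>' ` N'" using x c by (auto simp: N'_def)
    ultimately show "\<exists>T. open T \<and> z \<in> T \<and> smooth_on T (\<psi>' \<circ> f \<circ> inv_into U' \<phi>')"
      using T(1) by blast
  qed
  with cont show ?thesis unfolding smooth_map_def by blast
qed

lemma smooth_map_continuous: "smooth_map X A Y B f \<Longrightarrow> continuous_map X Y f"
  by (simp add: smooth_map_def)

lemma smooth_map_in_charts:
  assumes "smooth_map X A Y B f" "(U, \<phi>) \<in> A" "(V, \<psi>) \<in> B"
  shows "smooth_on (\<phi> ` {x \<in> U. f x \<in> V}) (\<psi> \<circ> f \<circ> inv_into U \<phi>)"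
proof -
  from assms(1) have "\<forall>(U, \<phi>)\<in>A. \<forall>(V, \<psi>)\<in>B.
      smooth_on (\<phi> ` {x \<in> U. f x \<in> V}) (\<psi> \<circ> f \<circ> inv_into U \<phi>)"
    unfolding smooth_map_def by (rule conjunct2)
  from bspec[OF this assms(2), unfolded prod.case]
  have "\<forall>(V, \<psi>)\<in>B. smooth_on (\<phi> ` {x \<in> U. f x \<in> V}) (\<psi> \<circ> f \<circ> inv_into U \<phi>)" .
  from bspec[OF this assms(3), unfolded prod.case] show ?thesis .
qed

lemma smooth_map_chart_domain_open:
  assumes M: "smooth_manifold X A" and M': "smooth_manifold Y B"
    and f: "smooth_map X A Y B f" and c: "(U, \<phi>) \<in> A" "(V, \<psi>) \<in> B"
  shows "openin X {x \<in> U. f x \<in> V}"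
proof -
  have "{x \<in> U. f x \<in> V} = U \<inter> {x \<in> topspace X. f x \<in> V}"
    using chart_subset_topspace[OF M c(1)] by auto
  then show ?thesis
    using openin_continuous_map_preimage[OF smooth_map_continuous[OF f] chart_domain_open[OF M' c(2)]]
      chart_domain_open[OF M c(1)] by auto
qed

lemma smooth_map_cong:
  assumes M: "smooth_manifold X A" and M': "smooth_manifold Y B"
    and f: "smooth_map X A Y B f" and eq: "\<And>x. x \<in> topspace X \<Longrightarrow> f x = g x"
  shows "smooth_map X A Y B g"
  unfolding smooth_map_def
proof (intro conjI ballI, safe)
  show "continuous_map X Y g"
    using smooth_map_continuous[OF f] eq by (rule continuous_map_eq)
  fix U \<phi> V \<psi> assume c: "(U, \<phi>) \<in> A" "(V, \<psi>) \<in> B"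
  have eq': "f x = g x" if "x \<in> U" for x using eq that chart_subset_topspace[OF M c(1)] by blast
  have "{x \<in> U. g x \<in> V} = {x \<in> U. f x \<in> V}" using eq' by auto
  moreover have "smooth_on (\<phi> ` {x \<in> U. f x \<in> V}) (\<psi> \<circ> g \<circ> inv_into U \<phi>)"
  proof (rule smooth_on_cong[OF _ _ smooth_map_in_charts[OF f c]])
    show "open (\<phi> ` {x \<in> U. f x \<in> V})"
      by (rule chart_open_image[OF M c(1) smooth_map_chart_domain_open[OF M M' f c]]) auto
  qed (use eq' chart_inv_into[OF M c(1)] in auto)
  ultimately show "smooth_on (\<phi> ` {x \<in> U. g x \<in> V}) (\<psi> \<circ> g \<circ> inv_into U \<phi>)" by simp
qed

lemma smooth_map_ident:
  assumes M: "smooth_manifold X A"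
  shows "smooth_map X A X A (\<lambda>x. x)"
  unfolding smooth_map_def
proof (intro conjI ballI, safe)
  fix U \<phi> V \<psi> assume "(U, \<phi>) \<in> A" "(V, \<psi>) \<in> A"
  from transition_map_smooth[OF M this]
  show "smooth_on (\<phi> ` {x \<in> U. x \<in> V}) (\<psi> \<circ> (\<lambda>x. x) \<circ> inv_into U \<phi>)"
    by (simp add: Int_def comp_def)
qed simp

lemma smooth_map_compose:
  fixes B :: "('b, 'f::real_inner) chart set"
  assumes M: "smooth_manifold X A" and M': "smooth_manifold Y B" and M'': "smooth_manifold Z C"
    and f: "smooth_map X A Y B f" and g: "smooth_map Y B Z C g"
  shows "smooth_map X A Z C (g \<circ> f)"
proof (rule smooth_mapI_local[OF M M''])
  fix x assume x: "x \<in> topspace X"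
  then have fx: "f x \<in> topspace Y"
    using smooth_map_continuous[OF f] by (auto simp: continuous_map_def)
  then have gfx: "g (f x) \<in> topspace Z"
    using smooth_map_continuous[OF g] by (auto simp: continuous_map_def)
  obtain U \<phi> where U: "(U, \<phi>) \<in> A" "x \<in> U" using chart_at[OF M x] .
  obtain V \<psi> where V: "(V, \<psi>) \<in> B" "f x \<in> V" using chart_at[OF M' fx] .
  obtain W \<omega> where W: "(W, \<omega>) \<in> C" "g (f x) \<in> W" using chart_at[OF M'' gfx] .
  define Q where "Q = {y \<in> V. g y \<in> W}"
  have Q: "openin Y Q" "Q \<subseteq> V"
    using smooth_map_chart_domain_open[OF M' M'' g V(1) W(1)] by (auto simp: Q_def)
  define N where "N = {x \<in> U. f x \<in> V} \<inter> {x \<in> topspace X. f x \<in> Q}"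
  have N: "openin X N" "N \<subseteq> U"
    using smooth_map_chart_domain_open[OF M M' f U(1) V(1)]
      openin_continuous_map_preimage[OF smooth_map_continuous[OF f] Q(1)] by (auto simp: N_def)
  have inv: "inv_into U \<phi> (\<phi> y) = y" if "y \<in> N" for y
    using that N chart_inv_into[OF M U(1)] by blast
  have "smooth_on (\<phi> ` N) ((\<omega> \<circ> g \<circ> inv_into V \<psi>) \<circ> (\<psi> \<circ> f \<circ> inv_into U \<phi>))"
  proof (rule smooth_on_compose[OF smooth_manifold_finite_dim[OF M']])
    show "open (\<phi> ` N)" by (rule chart_open_image[OF M U(1) N])
    show "open (\<psi> ` Q)" by (rule chart_open_image[OF M' V(1) Q])
    show "(\<psi> \<circ> f \<circ> inv_into U \<phi>) ` \<phi> ` N \<subseteq> \<psi> ` Q" using inv by (auto simp: N_def)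
    show "smooth_on (\<phi> ` N) (\<psi> \<circ> f \<circ> inv_into U \<phi>)"
      using smooth_map_in_charts[OF f U(1) V(1)] by (rule smooth_on_subset) (auto simp: N_def)
    show "smooth_on (\<psi> ` Q) (\<omega> \<circ> g \<circ> inv_into V \<psi>)"
      using smooth_map_in_charts[OF g V(1) W(1)] by (simp add: Q_def)
  qed
  then have "smooth_on (\<phi> ` N) (\<omega> \<circ> (g \<circ> f) \<circ> inv_into U \<phi>)"
    by (rule smooth_on_cong[OF chart_open_image[OF M U(1) N], rotated])
       (use inv chart_inv_into[OF M' V(1)] in \<open>auto simp: N_def\<close>)
  moreover have "x \<in> N" using U V W x by (auto simp: N_def Q_def)
  moreover have "(g \<circ> f) ` N \<subseteq> W" by (auto simp: N_def Q_def)
  ultimately show "\<exists>U \<phi> V \<psi> N. (U, \<phi>) \<in> A \<and> (V, \<psi>) \<in> C \<and> openin X N \<and> x \<in> N \<and> N \<subseteq> U \<and>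
      (g \<circ> f) ` N \<subseteq> V \<and> smooth_on (\<phi> ` N) (\<psi> \<circ> (g \<circ> f) \<circ> inv_into U \<phi>)"
    using U(1) W(1) N by blast
qed

section \<open>Diffeomorphisms form a group\<close>

lemma carrier_Diff_iff:
  "f \<in> carrier (Diff X A) \<longleftrightarrow> f \<in> Bij (topspace X) \<and> smooth_map X A X A f \<and>
     smooth_map X A X A (inv_into (topspace X) f)"
  by (simp add: Diff_def)

text \<open>
  Elements of the group are extensional, and their inverses are given by \<^const>\<open>inv_into\<close>; this rule
  constructs them from a pair of mutually inverse smooth maps with arbitrary values off the space.
\<close>

lemma restrict_in_Diff:
  assumes M: "smooth_manifold X A" and f: "smooth_map X A X A f" and g: "smooth_map X A X A g"
    and gf: "\<And>x. x \<in> topspace X \<Longrightarrow> g (f x) = x" and fg: "\<And>x. x \<in> topspace X \<Longrightarrow> f (g x) = x"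
  shows "restrict f (topspace X) \<in> carrier (Diff X A)"
proof -
  let ?f = "restrict f (topspace X)"
  have maps: "f x \<in> topspace X" "g x \<in> topspace X" if "x \<in> topspace X" for x
    using that smooth_map_continuous[OF f] smooth_map_continuous[OF g] by (auto simp: continuous_map_def)
  have bij: "bij_betw ?f (topspace X) (topspace X)"
    by (rule bij_betw_byWitness[where f' = g]) (use maps gf fg in auto)
  have "inv_into (topspace X) ?f x = g x" if "x \<in> topspace X" for x
    by (rule inv_into_f_eq) (use that maps fg bij in \<open>auto simp: bij_betw_def\<close>)
  then have "smooth_map X A X A (inv_into (topspace X) ?f)"
    by (intro smooth_map_cong[OF M M g]) simp
  moreover have "smooth_map X A X A ?f" by (rule smooth_map_cong[OF M M f]) simp
  ultimately show ?thesis using bij by (simp add: carrier_Diff_iff Bij_def)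
qed

lemma subgroup_Diff:
  assumes M: "smooth_manifold X A"
  shows "subgroup (carrier (Diff X A)) (BijGroup (topspace X))"
proof (rule subgroup.intro)
  let ?S = "topspace X"
  show "carrier (Diff X A) \<subseteq> carrier (BijGroup ?S)"
    by (auto simp: carrier_Diff_iff BijGroup_def)
  have inv1: "inv_into ?S f (f x) = x" and inv2: "f (inv_into ?S f x) = x"
    and maps: "f x \<in> ?S" "inv_into ?S f x \<in> ?S"
    if "f \<in> carrier (Diff X A)" "x \<in> ?S" for f x
    using that Bij_inv_into_mem[of f ?S x]
    by (auto simp: carrier_Diff_iff Bij_def bij_betw_def f_inv_into_f)
  fix f assume f: "f \<in> carrier (Diff X A)"
  show "inv\<^bsub>BijGroup ?S\<^esub> f \<in> carrier (Diff X A)"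
    using restrict_in_Diff[OF M, of "inv_into ?S f" f] inv1[OF f] inv2[OF f] f
    by (simp add: inv_BijGroup carrier_Diff_iff)
  fix g assume g: "g \<in> carrier (Diff X A)"
  have "restrict (f \<circ> g) ?S \<in> carrier (Diff X A)"
  proof (rule restrict_in_Diff[OF M])
    show "smooth_map X A X A (f \<circ> g)" "smooth_map X A X A (inv_into ?S g \<circ> inv_into ?S f)"
      using f g by (auto simp: carrier_Diff_iff intro: smooth_map_compose[OF M M M])
  qed (simp_all add: inv1[OF f] inv1[OF g] inv2[OF f] inv2[OF g] maps[OF f] maps[OF g])
  then show "f \<otimes>\<^bsub>BijGroup ?S\<^esub> g \<in> carrier (Diff X A)"
    using f g by (simp add: BijGroup_def carrier_Diff_iff compose_def comp_def)
next
  show "\<one>\<^bsub>BijGroup (topspace X)\<^esub> \<in> carrier (Diff X A)"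
    using restrict_in_Diff[OF M smooth_map_ident[OF M] smooth_map_ident[OF M]]
    by (simp add: BijGroup_def)
qed

lemma Diff_eq_subgroup: "Diff X A = BijGroup (topspace X)\<lparr>carrier := carrier (Diff X A)\<rparr>"
  by (simp add: Diff_def)

lemma group_Diff: "smooth_manifold X A \<Longrightarrow> group (Diff X A)"
  by (subst Diff_eq_subgroup) (rule subgroup.subgroup_is_group[OF subgroup_Diff group_BijGroup])

lemma Diff_mult_apply:
  assumes "f \<in> carrier (Diff X A)" "g \<in> carrier (Diff X A)" "x \<in> topspace X"
  shows "(f \<otimes>\<^bsub>Diff X A\<^esub> g) x = f (g x)"
  using assms by (simp add: Diff_def BijGroup_def compose_def)

lemma Diff_one_apply: "x \<in> topspace X \<Longrightarrow> \<one>\<^bsub>Diff X A\<^esub> x = x"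
  by (simp add: Diff_def BijGroup_def)

lemma Diff_apply_inject:
  "f \<in> carrier (Diff X A) \<Longrightarrow> x \<in> topspace X \<Longrightarrow> y \<in> topspace X \<Longrightarrow> f x = f y \<longleftrightarrow> x = y"
  by (auto simp: carrier_Diff_iff Bij_def bij_betw_def dest: inj_onD)

lemma Diff_apply_in: "f \<in> carrier (Diff X A) \<Longrightarrow> x \<in> topspace X \<Longrightarrow> f x \<in> topspace X"
  by (auto simp: carrier_Diff_iff Bij_def bij_betw_def)

lemma Diff_eqI:
  assumes "f \<in> carrier (Diff X A)" "g \<in> carrier (Diff X A)"
    "\<And>x. x \<in> topspace X \<Longrightarrow> f x = g x"
  shows "f = g"
  using assms by (auto simp: carrier_Diff_iff Bij_def intro: extensionalityI)

lemma Diff_inv_apply_eq: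
  assumes M: "smooth_manifold X A" and f: "f \<in> carrier (Diff X A)"
    and x: "x \<in> topspace X" and fx: "f x = y"
  shows "(inv\<^bsub>Diff X A\<^esub> f) y = x"
proof -
  interpret group "Diff X A" by (rule group_Diff[OF M])
  have "(inv\<^bsub>Diff X A\<^esub> f) (f x) = x"
    using Diff_mult_apply[OF inv_closed[OF f] f x] f x by (simp add: Diff_one_apply)
  then show ?thesis by (simp add: fx)
qed

section \<open>Counting continuous maps\<close>

text \<open>
  If \<open>f x \<noteq> g x\<close>, some basic open \<open>c\<close> contains \<open>f x\<close> but not \<open>g x\<close>, and by continuity \<open>f\<close> maps some basic
  neighbourhood \<open>b\<close> of \<open>x\<close> into \<open>c\<close>, while \<open>g\<close> does not. So the map is coded by a set of pairs of
  members of countable bases, and sets of natural numbers are as many as the reals.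
\<close>

lemma continuous_maps_inject_into_reals:
  assumes X: "second_countable X" and Y: "second_countable Y" "Hausdorff_space Y"
  obtains \<iota> :: "('a \<Rightarrow> 'b) \<Rightarrow> real"
  where "inj_on \<iota> {f \<in> extensional (topspace X). continuous_map X Y f}"
proof -
  obtain \<B> where \<B>: "countable \<B>" "\<And>V. V \<in> \<B> \<Longrightarrow> openin X V"
    "\<And>U x. openin X U \<Longrightarrow> x \<in> U \<Longrightarrow> \<exists>V\<in>\<B>. x \<in> V \<and> V \<subseteq> U"
    using X unfolding second_countable_def by metis
  obtain \<C> where \<C>: "countable \<C>" "\<And>V. V \<in> \<C> \<Longrightarrow> openin Y V"
    "\<And>U x. openin Y U \<Longrightarrow> x \<in> U \<Longrightarrow> \<exists>V\<in>\<C>. x \<in> V \<and> V \<subseteq> U"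
    using Y(1) unfolding second_countable_def by metis
  obtain k :: "nat set \<Rightarrow> real" where k: "inj k"
    using nat_sets_eqpoll_reals by (auto simp: eqpoll_def bij_betw_def)
  define e where "e = to_nat_on (\<B> \<times> \<C>)"
  have e: "inj_on e (\<B> \<times> \<C>)" 
    unfolding e_def using \<B>(1) \<C>(1) by (intro inj_on_to_nat_on countable_SIGMA)
  define J where "J f = {(b, c) \<in> \<B> \<times> \<C>. f ` b \<subseteq> c}" for f
  have "inj_on (\<lambda>f. k (e ` J f)) {f \<in> extensional (topspace X). continuous_map X Y f}"
  proof (rule inj_onI, safe)
    fix f g assume f: "f \<in> extensional (topspace X)" "continuous_map X Y f"
      and g: "g \<in> extensional (topspace X)" "continuous_map X Y g"
      and eq: "k (e ` J f) = k (e ` J g)"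
    then have "e ` J f = e ` J g" using k by (auto dest: injD)
    then have J: "J f = J g"
      by (subst (asm) inj_on_image_eq_iff[OF e]) (auto simp: J_def)
    show "f = g"
    proof (rule extensionalityI[OF f(1) g(1)], rule ccontr)
      fix x assume x: "x \<in> topspace X" and neq: "f x \<noteq> g x"
      have "f x \<in> topspace Y" "g x \<in> topspace Y"
        using x f(2) g(2) by (auto simp: continuous_map_def)
      then obtain V W where VW: "openin Y V" "f x \<in> V" "g x \<in> W" "disjnt V W"
        using Y(2) neq unfolding Hausdorff_space_def by metis
      obtain c where c: "c \<in> \<C>" "f x \<in> c" "c \<subseteq> V" using \<C>(3)[OF VW(1,2)] by blast
      have "openin X {z \<in> topspace X. f z \<in> c}"
        using openin_continuous_map_preimage[OF f(2) \<C>(2)[OF c(1)]] .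
      moreover have "x \<in> {z \<in> topspace X. f z \<in> c}" using x c by simp
      ultimately obtain b where b: "b \<in> \<B>" "x \<in> b" "b \<subseteq> {z \<in> topspace X. f z \<in> c}"
        using \<B>(3) by meson
      have "(b, c) \<in> J f" using b c by (auto simp: J_def)
      then have "(b, c) \<in> J g" by (simp only: J)
      then have "g x \<in> c" using b(2) by (auto simp: J_def)
      then show False using c(3) VW by (auto simp: disjnt_def)
    qed
  qed
  then show ?thesis by (rule that)
qed

section \<open>Diffeomorphisms with small support\<close>

text \<open>
  The extended map is smooth near the points of the chart domain, and it is the identity off the
  preimage \<open>K\<close> of the ball. These two open sets cover the space since \<open>K\<close> is closed, being compact in a
  Hausdorff space.
\<close>

lemma smooth_map_extend_by_identity:
  fixes F :: "'e::real_inner \<Rightarrow> 'e"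
  assumes M: "smooth_manifold X A" and c: "(U, \<phi>) \<in> A" and sub: "cball p r \<subseteq> \<phi> ` U"
    and F: "smooth_on UNIV F" "F ` cball p r \<subseteq> cball p r" "\<And>x. x \<notin> cball p r \<Longrightarrow> F x = x"
  shows "smooth_map X A X A (\<lambda>x. if x \<in> U then inv_into U \<phi> (F (\<phi> x)) else x)" (is "smooth_map X A X A ?f")
proof (rule smooth_mapI_local[OF M M])
  fix x assume x: "x \<in> topspace X"
  define K where "K = {y \<in> U. \<phi> y \<in> cball p r}"
  have F_in: "F z \<in> \<phi> ` U" if "z \<in> \<phi> ` U" for z
    using that F sub by (metis image_subset_iff subsetD)
  have outside: "?f y = y" if "y \<notin> K" for y
    using that F(3) chart_inv_into[OF M c] by (auto simp: K_def)
  have "closedin X K"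
  proof -
    obtain g where g: "homeomorphic_maps (subtopology X U) (top_of_set (\<phi> ` U)) \<phi> g"
      using chart_homeomorphic_map[OF M c] homeomorphic_map_maps by blast
    have topU: "topspace (subtopology X U) = U" using chart_subset_topspace[OF M c] by auto
    have "compactin (top_of_set (\<phi> ` U)) (cball p r)"
      using compact_cball_if_finite_dim[OF smooth_manifold_finite_dim[OF M]] sub
      by (simp add: compactin_subtopology)
    then have "compactin (subtopology X U) (g ` cball p r)"
      by (rule image_compactin) (use g in \<open>simp add: homeomorphic_maps_def\<close>)
    moreover have "g ` cball p r = K"
    proof (intro equalityI subsetI)
      fix y assume "y \<in> g ` cball p r"
      then obtain z where z: "z \<in> cball p r" "y = g z" by blast
      then have "z \<in> \<phi> ` U" using sub by blast
      then have "\<phi> (g z) = z" "g z \<in> U"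
        using g topU unfolding homeomorphic_maps_def continuous_map_def by auto
      then show "y \<in> K" using z by (simp add: K_def)
    next
      fix y assume "y \<in> K"
      then have "g (\<phi> y) = y" "\<phi> y \<in> cball p r"
        using g topU by (auto simp: homeomorphic_maps_def K_def)
      then show "y \<in> g ` cball p r" by (metis imageI)
    qed
    ultimately have "compactin X K" by (simp add: compactin_subtopology)
    then show ?thesis
      using M by (intro compactin_imp_closedin) (auto simp: smooth_manifold_def)
  qed
  show "\<exists>U' \<phi>' V \<psi> N. (U', \<phi>') \<in> A \<and> (V, \<psi>) \<in> A \<and> openin X N \<and> x \<in> N \<and> N \<subseteq> U' \<and>
      ?f ` N \<subseteq> V \<and> smooth_on (\<phi>' ` N) (\<psi> \<circ> ?f \<circ> inv_into U' \<phi>')"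
  proof (cases "x \<in> U")
    case True
    have "smooth_on (\<phi> ` U) (\<phi> \<circ> ?f \<circ> inv_into U \<phi>)"
    proof (rule smooth_on_cong[OF chart_image_open[OF M c] _ smooth_on_subset[OF F(1)]])
      fix z assume z: "z \<in> \<phi> ` U"
      then show "F z = (\<phi> \<circ> ?f \<circ> inv_into U \<phi>) z"
        using F_in[OF z] by (simp add: inv_into_into f_inv_into_f)
    qed simp
    moreover have "?f ` U \<subseteq> U" using F_in by (auto intro: inv_into_into)
    ultimately show ?thesis using c True chart_domain_open[OF M c] by blast
  next
    case False
    obtain V \<psi> where V: "(V, \<psi>) \<in> A" "x \<in> V" using chart_at[OF M x] .
    let ?N = "V - K"
    have N: "openin X ?N" using chart_domain_open[OF M V(1)] \<open>closedin X K\<close> by (rule openin_diff)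
    have "smooth_on (\<psi> ` ?N) (\<psi> \<circ> ?f \<circ> inv_into V \<psi>)"
    proof (rule smooth_on_cong[OF chart_open_image[OF M V(1) N] _ smooth_on_ident])
      fix z assume "z \<in> \<psi> ` ?N"
      then obtain y where y: "y \<in> V" "y \<notin> K" "z = \<psi> y" by blast
      then show "z = (\<psi> \<circ> ?f \<circ> inv_into V \<psi>) z"
        using chart_inv_into[OF M V(1) y(1)] outside[OF y(2)] by (simp only: comp_def)
    qed blast
    moreover have "?f ` ?N \<subseteq> V" using outside by fastforce
    moreover have "x \<in> ?N" using False V(2) by (simp add: K_def)
    ultimately show ?thesis using V(1) N by blast
  qed
qed

lemma Diff_supported_in_open_set:
  fixes A :: "('a, 'e::real_inner) chart set"
  assumes M: "smooth_manifold X A" and dim: "\<exists>v::'e. v \<noteq> 0" and W: "openin X W" "p \<in> W"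
  obtains f where "f \<in> carrier (Diff X A)" "f p \<noteq> p" "\<And>x. x \<in> topspace X - W \<Longrightarrow> f x = x"
proof -
  have p: "p \<in> topspace X" using W openin_subset by blast
  obtain U \<phi> where c: "(U, \<phi>) \<in> A" "p \<in> U" using chart_at[OF M p] .
  have "open (\<phi> ` (U \<inter> W))"
    using chart_domain_open[OF M c(1)] W by (intro chart_open_image[OF M c(1)]) auto
  moreover have "\<phi> p \<in> \<phi> ` (U \<inter> W)" using c W by blast
  ultimately obtain r where r: "0 < r" "cball (\<phi> p) r \<subseteq> \<phi> ` (U \<inter> W)"
    using open_contains_cball by blast
  obtain F h where F: "smooth_on UNIV F" and h: "smooth_on UNIV h"
    and id: "h \<circ> F = id" "F \<circ> h = id" and Fp: "F (\<phi> p) \<noteq> \<phi> p"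
    and supp: "{x. F x \<noteq> x} \<subseteq> cball (\<phi> p) r"
    using compactly_supported_diffeomorphism[OF smooth_manifold_finite_dim[OF M] dim r(1), where p = "\<phi> p"]
    by blast
  note hF = pointfree_idE[OF id(1)] and Fh = pointfree_idE[OF id(2)]
  have F_out: "F x = x" if "x \<notin> cball (\<phi> p) r" for x using supp that by blast
  have h_out: "h x = x" if "x \<notin> cball (\<phi> p) r" for x using hF[of x] F_out[OF that] by simp
  have F_in: "F x \<in> cball (\<phi> p) r" if x: "x \<in> cball (\<phi> p) r" for x
  proof (rule ccontr)
    assume "F x \<notin> cball (\<phi> p) r"
    then show False using h_out[of "F x"] hF[of x] x by simp
  qed
  have h_in: "h x \<in> cball (\<phi> p) r" if x: "x \<in> cball (\<phi> p) r" for x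
  proof (rule ccontr)
    assume "h x \<notin> cball (\<phi> p) r"
    then show False using F_out[of "h x"] Fh[of x] x by simp
  qed
  have sub: "cball (\<phi> p) r \<subseteq> \<phi> ` U" using r(2) by blast
  have in_U: "F z \<in> \<phi> ` U" "h z \<in> \<phi> ` U" if "z \<in> \<phi> ` U" for z
    using that subsetD[OF sub F_in[of z]] subsetD[OF sub h_in[of z]] F_out[of z] h_out[of z]
    by (cases "z \<in> cball (\<phi> p) r"; simp)+
  define f where "f x = (if x \<in> U then inv_into U \<phi> (F (\<phi> x)) else x)" for x
  define g where "g x = (if x \<in> U then inv_into U \<phi> (h (\<phi> x)) else x)" for x
  have sf: "smooth_map X A X A f"
    unfolding f_def using F_in F_out by (intro smooth_map_extend_by_identity[OF M c(1) sub F]) auto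
  have sg: "smooth_map X A X A g"
    unfolding g_def using h_in h_out by (intro smooth_map_extend_by_identity[OF M c(1) sub h]) auto
  have gf: "g (f x) = x" and fg: "f (g x) = x" for x
    using in_U[of "\<phi> x"] chart_inv_into[OF M c(1)]
    by (auto simp: f_def g_def inv_into_into f_inv_into_f hF Fh)
  show ?thesis
  proof (rule that)
    show "restrict f (topspace X) \<in> carrier (Diff X A)"
      by (rule restrict_in_Diff[OF M sf sg gf fg])
    have "\<phi> (f p) = F (\<phi> p)" using c in_U[of "\<phi> p"] by (simp add: f_def f_inv_into_f)
    then show "restrict f (topspace X) p \<noteq> p" using Fp p by auto
    fix x assume x: "x \<in> topspace X - W"
    have "f x = x"
    proof (cases "x \<in> U")
      case True
      then have "\<phi> x \<notin> \<phi> ` (U \<inter> W)" using x chart_inj[OF M c(1)] by (auto dest: inj_onD)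
      then have "F (\<phi> x) = \<phi> x" using r(2) F_out by blast
      then show ?thesis using True chart_inv_into[OF M c(1)] by (simp add: f_def)
    qed (simp add: f_def)
    then show "restrict f (topspace X) x = x" using x by simp
  qed
qed

text \<open>In dimension 0 every chart domain is a single point, so the space is discrete.\<close>

lemma smooth_map_dim_0:
  fixes A :: "('a, 'e::real_inner) chart set"
  assumes M: "smooth_manifold X A" and dim: "\<And>v::'e. v = 0"
    and f: "f \<in> topspace X \<rightarrow> topspace X"
  shows "smooth_map X A X A f"
proof (rule smooth_mapI_local[OF M M])
  fix x assume x: "x \<in> topspace X"
  have fx: "f x \<in> topspace X" using funcset_mem[OF f x] .
  obtain U \<phi> where U: "(U, \<phi>) \<in> A" "x \<in> U" using chart_at[OF M x] .
  obtain V \<psi> where V: "(V, \<psi>) \<in> A" "f x \<in> V" using chart_at[OF M fx] .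
  have "y = x" if "y \<in> U" for y
  proof -
    have "\<phi> y = \<phi> x" using dim[of "\<phi> y"] dim[of "\<phi> x"] by simp
    then show ?thesis using inj_onD[OF chart_inj[OF M U(1)] _ that U(2)] by blast
  qed
  then have "U = {x}" using U(2) by blast
  moreover have "smooth_on (\<phi> ` U) (\<psi> \<circ> f \<circ> inv_into U \<phi>)"
  proof -
    have "(\<psi> \<circ> f \<circ> inv_into U \<phi>) = (\<lambda>_. 0)" by (intro ext dim)
    then show ?thesis by (simp add: smooth_on_const)
  qed
  ultimately show "\<exists>U \<phi> V \<psi> N. (U, \<phi>) \<in> A \<and> (V, \<psi>) \<in> A \<and> openin X N \<and> x \<in> N \<and> N \<subseteq> U \<and>
      f ` N \<subseteq> V \<and> smooth_on (\<phi> ` N) (\<psi> \<circ> f \<circ> inv_into U \<phi>)"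
    using U(1) V chart_domain_open[OF M U(1)] by blast
qed

section \<open>The diffeomorphism group is natural\<close>

text \<open>
  All three inequalities are read off at the point \<open>p\<close>. In positive dimension \<open>y\<close> and its inverse fix
  \<open>x p\<close>, so \<open>y x\<close> and \<open>y\<inverse> x\<close> both send \<open>p\<close> to \<open>x p\<close>, unlike \<open>x y\<close>, since \<open>y\<close> moves \<open>p\<close>; and \<open>y\<^sup>2\<close> keeps \<open>p\<close> inside
  \<open>W\<close>, unlike \<open>x\<^sup>2\<close>. In dimension 0, where \<open>y\<close> interchanges \<open>p\<close> and \<open>x p\<close>, the maps \<open>y x = y\<inverse> x\<close> and \<open>y\<^sup>2\<close> fix
  \<open>p\<close>, whereas \<open>x y\<close> and \<open>x\<^sup>2\<close> send it to \<open>x (x p)\<close>.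
\<close>

lemma Diff_noncommuting_witness:
  fixes A :: "('a, 'e::real_inner) chart set"
  assumes M: "smooth_manifold X A" and x: "x \<in> carrier (Diff X A)"
    and xx: "x \<otimes>\<^bsub>Diff X A\<^esub> x \<noteq> \<one>\<^bsub>Diff X A\<^esub>"
  shows "\<exists>y\<in>carrier (Diff X A). x \<otimes>\<^bsub>Diff X A\<^esub> y \<noteq> y \<otimes>\<^bsub>Diff X A\<^esub> x \<and>
    x \<otimes>\<^bsub>Diff X A\<^esub> y \<noteq> inv\<^bsub>Diff X A\<^esub> y \<otimes>\<^bsub>Diff X A\<^esub> x \<and> y \<otimes>\<^bsub>Diff X A\<^esub> y \<noteq> x \<otimes>\<^bsub>Diff X A\<^esub> x"
proof -
  interpret group "Diff X A" by (rule group_Diff[OF M])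
  note apply_simps = Diff_mult_apply Diff_one_apply Diff_apply_in Diff_apply_inject
  obtain p where p: "p \<in> topspace X" "x (x p) \<noteq> p"
  proof -
    have "\<exists>p\<in>topspace X. (x \<otimes>\<^bsub>Diff X A\<^esub> x) p \<noteq> \<one>\<^bsub>Diff X A\<^esub> p"
      using Diff_eqI[OF m_closed[OF x x] one_closed] xx by blast
    then show ?thesis using that x by (auto simp: apply_simps)
  qed
  define q where "q = x p"
  have q: "q \<in> topspace X" "x q \<in> topspace X" "q \<noteq> p" "x q \<noteq> p"
    using p x by (auto simp: q_def Diff_apply_in)
  show ?thesis
  proof (cases "\<exists>v::'e. v \<noteq> 0")
    case True
    have cont: "continuous_map X X x"
      using x by (auto simp: carrier_Diff_iff intro: smooth_map_continuous)
    have H: "Hausdorff_space X" using M by (simp add: smooth_manifold_def)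
    obtain P1 Q1 where 1: "openin X P1" "openin X Q1" "p \<in> P1" "q \<in> Q1" "disjnt P1 Q1"
      using H p(1) q(1,3) unfolding Hausdorff_space_def by metis
    obtain P2 Q2 where 2: "openin X P2" "openin X Q2" "p \<in> P2" "x q \<in> Q2" "disjnt P2 Q2"
      using H p(1) q(2,4) unfolding Hausdorff_space_def by metis
    define W where "W = P1 \<inter> P2 \<inter> {z \<in> topspace X. x z \<in> Q1} \<inter> {z \<in> topspace X. (x \<circ> x) z \<in> Q2}"
    have "openin X W"
      unfolding W_def using 1 2 cont
      by (intro openin_Int openin_continuous_map_preimage[OF cont]
          openin_continuous_map_preimage[OF continuous_map_compose[OF cont cont]]) auto
    moreover have pW: "p \<in> W" using 1 2 p(1) by (auto simp: W_def q_def)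
    ultimately obtain y where y: "y \<in> carrier (Diff X A)" "y p \<noteq> p"
      and y_out: "\<And>z. z \<in> topspace X - W \<Longrightarrow> y z = z"
      using Diff_supported_in_open_set[OF M True] by blast
    have W_out: "q \<notin> W" "x q \<notin> W" using 1 2 by (auto simp: W_def disjnt_def)
    \<comment> \<open>\<open>y\<close> is injective and fixes every point off \<open>W\<close>, so it cannot leave \<open>W\<close>\<close>
    have y_in: "y z \<in> W" if "z \<in> W" for z
    proof (rule ccontr)
      have z: "z \<in> topspace X" using that by (auto simp: W_def)
      assume out: "y z \<notin> W"
      then have "y (y z) = y z" using y_out y(1) z by (simp add: Diff_apply_in)
      then have "y z = z" using y(1) z by (simp add: apply_simps)
      then show False using out that by simp
    qed
    have yq: "y q = q" using y_out q W_out by simp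
    have inv_y: "(inv\<^bsub>Diff X A\<^esub> y) q = q" by (rule Diff_inv_apply_eq[OF M y(1) q(1) yq])
    have xyp: "(x \<otimes>\<^bsub>Diff X A\<^esub> y) p \<noteq> q"
      using x y p by (simp add: apply_simps q_def)
    have "(y \<otimes>\<^bsub>Diff X A\<^esub> x) p = q" "(inv\<^bsub>Diff X A\<^esub> y \<otimes>\<^bsub>Diff X A\<^esub> x) p = q"
      using x y(1) p(1) yq inv_y by (simp_all add: Diff_mult_apply flip: q_def)
    moreover have "(y \<otimes>\<^bsub>Diff X A\<^esub> y) p \<in> W" "(x \<otimes>\<^bsub>Diff X A\<^esub> x) p \<notin> W"
      using x y(1) p(1) pW y_in W_out by (simp_all add: Diff_mult_apply flip: q_def)
    ultimately show ?thesis using xyp y(1) by metis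
  next
    case False
    then have dim: "\<And>v::'e. v = 0" by blast
    define t where "t = Transposition.transpose p q"
    have "t \<in> topspace X \<rightarrow> topspace X"
      using p(1) q(1) by (auto simp: t_def Transposition.transpose_def)
    then have t: "smooth_map X A X A t" by (rule smooth_map_dim_0[OF M dim])
    define y where "y = restrict t (topspace X)"
    have y: "y \<in> carrier (Diff X A)"
      unfolding y_def by (rule restrict_in_Diff[OF M t t]) (simp_all add: t_def)
    have yp: "y p = q" "y q = p" using p(1) q(1) by (simp_all add: y_def t_def)
    have inv_y: "(inv\<^bsub>Diff X A\<^esub> y) q = p" by (rule Diff_inv_apply_eq[OF M y p(1) yp(1)])
    have "(x \<otimes>\<^bsub>Diff X A\<^esub> y) p = x q" "(y \<otimes>\<^bsub>Diff X A\<^esub> x) p = p"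
      "(inv\<^bsub>Diff X A\<^esub> y \<otimes>\<^bsub>Diff X A\<^esub> x) p = p" "(y \<otimes>\<^bsub>Diff X A\<^esub> y) p = p"
      "(x \<otimes>\<^bsub>Diff X A\<^esub> x) p = x q"
      using x y p(1) yp inv_y by (simp_all add: Diff_mult_apply flip: q_def)
    then show ?thesis using q(4) y by metis
  qed
qed

theorem corollary12:
  fixes X :: "'a topology" and A :: "('a, 'e::real_inner) chart set"
  assumes "smooth_manifold X A" and "second_countable X"
  shows "natural_group (Diff X A)"
proof -
  have "Hausdorff_space X" using assms(1) by (simp add: smooth_manifold_def)
  then obtain \<iota> :: "('a \<Rightarrow> 'a) \<Rightarrow> real"
    where \<iota>: "inj_on \<iota> {f \<in> extensional (topspace X). continuous_map X X f}"
    using continuous_maps_inject_into_reals[OF assms(2) assms(2)] by blast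
  have "carrier (Diff X A) \<subseteq> {f \<in> extensional (topspace X). continuous_map X X f}"
    by (auto simp: carrier_Diff_iff Bij_def smooth_map_def)
  with \<iota> have "inj_on \<iota> (carrier (Diff X A))" by (rule inj_on_subset)
  then show ?thesis
    by (rule natural_groupI[OF group_Diff[OF assms(1)] _ Diff_noncommuting_witness[OF assms(1)]])
qed

end
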